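(* If a geodesic metric space $X$ is quasi-isometric to a cactus, then there are a constant $K$ and a cactus $Q$ such that $X$ and $Q$ are $(1,K)$-quasi-isometric.
   Context: A cactus is a connected graph in which any two distinct simple cycles have at most one vertex in common. Graphs are endowed with their path metrics (every edge has length one). "Quasi-isometric" has its usual meaning, with arbitrary multiplicative and additive constants. A map $F:X\to Y$ of metric spaces is a $(1,K)$-quasi-isometry if $|d_Y(F(x),F(y))-d_X(x,y)|\le K$ for all $x,y\in X$ and every point of $Y$ lies at distance at most $K$ from $F(X)$. $X$ and $Y$ are $(1,K)$-quasi-isometric if there is a $(1,K)$-quasi-isometry $X\to Y$. *)

theory Defs
  imports "HOL-Analysis.Abstract_Metric_Spaces"
begin

section \<open>Geodesic spaces and quasi-isometries\<close>

definition geodesic_space :: "'a set \<Rightarrow> ('a \<Rightarrow> 'a \<Rightarrow> real) \<Rightarrow> bool" where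
  "geodesic_space M d \<longleftrightarrow> Metric_space M d \<and>
     (\<forall>x\<in>M. \<forall>y\<in>M. \<exists>\<gamma>. \<gamma> ` {0..d x y} \<subseteq> M \<and> \<gamma> 0 = x \<and> \<gamma> (d x y) = y \<and>
        (\<forall>s\<in>{0..d x y}. \<forall>t\<in>{0..d x y}. d (\<gamma> s) (\<gamma> t) = \<bar>s - t\<bar>))"

definition quasi_isometric ::
  "'a set \<Rightarrow> ('a \<Rightarrow> 'a \<Rightarrow> real) \<Rightarrow> 'b set \<Rightarrow> ('b \<Rightarrow> 'b \<Rightarrow> real) \<Rightarrow> bool" where
  "quasi_isometric X dX Y dY \<longleftrightarrow>
     (\<exists>F L C. F ` X \<subseteq> Y \<and> L \<ge> 1 \<and> C \<ge> 0 \<and>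
        (\<forall>x\<in>X. \<forall>x'\<in>X. dX x x' / L - C \<le> dY (F x) (F x') \<and> dY (F x) (F x') \<le> L * dX x x' + C) \<and>
        (\<forall>y\<in>Y. \<exists>x\<in>X. dY y (F x) \<le> C))"

definition quasi_isometry_1 ::
  "real \<Rightarrow> 'a set \<Rightarrow> ('a \<Rightarrow> 'a \<Rightarrow> real) \<Rightarrow> 'b set \<Rightarrow> ('b \<Rightarrow> 'b \<Rightarrow> real) \<Rightarrow> ('a \<Rightarrow> 'b) \<Rightarrow> bool" where
  "quasi_isometry_1 K X dX Y dY F \<longleftrightarrow>
     F ` X \<subseteq> Y \<and>
     (\<forall>x\<in>X. \<forall>x'\<in>X. \<bar>dY (F x) (F x') - dX x x'\<bar> \<le> K) \<and>
     (\<forall>y\<in>Y. \<exists>x\<in>X. dY y (F x) \<le> K)"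

definition quasi_isometric_1 ::
  "real \<Rightarrow> 'a set \<Rightarrow> ('a \<Rightarrow> 'a \<Rightarrow> real) \<Rightarrow> 'b set \<Rightarrow> ('b \<Rightarrow> 'b \<Rightarrow> real) \<Rightarrow> bool" where
  "quasi_isometric_1 K X dX Y dY \<longleftrightarrow> (\<exists>F. quasi_isometry_1 K X dX Y dY F)"

section \<open>Cacti\<close>

text \<open>Graphs are simple and undirected, of arbitrary cardinality: \<open>V\<close> is the set of vertices
  and \<open>E\<close> the set of edges, an edge being the set of its two ends.\<close>

definition simple_graph :: "'v set \<Rightarrow> 'v set set \<Rightarrow> bool" where
  "simple_graph V E \<longleftrightarrow> (\<forall>e\<in>E. e \<subseteq> V \<and> card e = 2)"

definition connected_graph :: "'v set \<Rightarrow> 'v set set \<Rightarrow> bool" where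
  "connected_graph V E \<longleftrightarrow> simple_graph V E \<and> V \<noteq> {} \<and>
     (\<forall>u\<in>V. \<forall>v\<in>V. (u, v) \<in> {(a, b). {a, b} \<in> E}\<^sup>*)"

definition cycle_edges :: "'v list \<Rightarrow> 'v set set" where
  "cycle_edges c = {{c ! i, c ! (Suc i mod length c)} | i. i < length c}"

definition simple_cycle :: "'v set \<Rightarrow> 'v set set \<Rightarrow> 'v list \<Rightarrow> bool" where
  "simple_cycle V E c \<longleftrightarrow> length c \<ge> 3 \<and> distinct c \<and> set c \<subseteq> V \<and> cycle_edges c \<subseteq> E"

text \<open>A cycle is a subgraph, so lists that differ by a rotation or a reversal describe the same
  cycle; two cycles are distinct when their edge sets are.\<close>

definition cactus :: "'v set \<Rightarrow> 'v set set \<Rightarrow> bool" where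
  "cactus V E \<longleftrightarrow> connected_graph V E \<and>
     (\<forall>c c'. simple_cycle V E c \<and> simple_cycle V E c' \<and> cycle_edges c \<noteq> cycle_edges c' \<longrightarrow>
        card (set c \<inter> set c') \<le> 1)"

text \<open>HOL cannot quantify existentially over types, so vertices of a graph whose existence is
  claimed are named by tuples of subsets of one type, elements of another, and numbers. This
  is no restriction in what follows: a cactus that is \<open>(1, K)\<close>-quasi-isometric to \<open>X\<close>
  contains an isometric subcactus with the same property for some constant, and with at most
  \<open>max |X| \<aleph>\<^sub>0\<close> vertices.\<close>

type_synonym ('a, 'v) label = "('a set + 'v + nat) list"

section \<open>The path metric of a graph\<close>

text \<open>As a metric space, a graph is its geometric realization, in which every edge is a unit
  interval. A point is given by its barycentric coordinates: the vertex \<open>v\<close> is the indicator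
  function of \<open>v\<close>, and the point at distance \<open>t\<close> from \<open>u\<close> on the edge \<open>{u, v}\<close> has coordinate
  \<open>1 - t\<close> at \<open>u\<close>, \<open>t\<close> at \<open>v\<close>, and \<open>0\<close> elsewhere.\<close>

definition supp :: "('v \<Rightarrow> real) \<Rightarrow> 'v set" where
  "supp x = {v. x v \<noteq> 0}"

definition realization :: "'v set \<Rightarrow> 'v set set \<Rightarrow> ('v \<Rightarrow> real) set" where
  "realization V E = {x. (\<forall>v. 0 \<le> x v) \<and> sum x (supp x) = 1 \<and>
     ((\<exists>v\<in>V. supp x = {v}) \<or> supp x \<in> E)}"

text \<open>The factor 1/2 makes the two ends of an edge lie at distance 1.\<close>

definition seg_length :: "('v \<Rightarrow> real) \<Rightarrow> ('v \<Rightarrow> real) \<Rightarrow> real" where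
  "seg_length x y = (\<Sum>v\<in>supp x \<union> supp y. \<bar>x v - y v\<bar>) / 2"

text \<open>\<open>pl_path V E x y l\<close>: some path from \<open>x\<close> to \<open>y\<close> that is a concatenation of finitely many
  segments, each contained in one edge, has length \<open>l\<close>.\<close>

inductive pl_path :: "'v set \<Rightarrow> 'v set set \<Rightarrow> ('v \<Rightarrow> real) \<Rightarrow> ('v \<Rightarrow> real) \<Rightarrow> real \<Rightarrow> bool"
  for V E where
  refl: "x \<in> realization V E \<Longrightarrow> pl_path V E x x 0"
| step: "x \<in> realization V E \<Longrightarrow> y \<in> realization V E \<Longrightarrow> e \<in> E \<Longrightarrow> supp x \<subseteq> e \<Longrightarrow> supp y \<subseteq> e \<Longrightarrow>
         pl_path V E y z l \<Longrightarrow> pl_path V E x z (seg_length x y + l)"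

text \<open>The default value 0 concerns only points outside the realization, where
  \<open>Metric_space\<close> still asks for a nonnegative distance, and disconnected graphs.\<close>

definition path_dist :: "'v set \<Rightarrow> 'v set set \<Rightarrow> ('v \<Rightarrow> real) \<Rightarrow> ('v \<Rightarrow> real) \<Rightarrow> real" where
  "path_dist V E x y = (if \<exists>l. pl_path V E x y l then Inf {l. pl_path V E x y l} else 0)"

lemma realization_supp:
  assumes "simple_graph V E" "x \<in> realization V E"
  shows "finite (supp x)" "supp x \<subseteq> V" "supp x \<noteq> {}"
proof -
  from assms(2) consider v where "v \<in> V" "supp x = {v}" | "supp x \<in> E"
    by (auto simp: realization_def)
  then have "finite (supp x) \<and> supp x \<subseteq> V \<and> supp x \<noteq> {}"
  proof cases
    case 2
    then have "card (supp x) = 2" "supp x \<subseteq> V" using assms(1) by (auto simp: simple_graph_def)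
    then show ?thesis by (metis card.empty card.infinite zero_neq_numeral)
  qed auto
  then show "finite (supp x)" "supp x \<subseteq> V" "supp x \<noteq> {}" by auto
qed

lemma seg_length_nonneg: "seg_length x y \<ge> 0"
  by (simp add: seg_length_def sum_nonneg)

lemma seg_length_commute: "seg_length x y = seg_length y x"
  by (simp add: seg_length_def Un_commute abs_minus_commute)

lemma coordinate_le_seg_length:
  assumes "simple_graph V E" "x \<in> realization V E" "y \<in> realization V E"
  shows "\<bar>x v - y v\<bar> \<le> seg_length x y"
proof (cases "v \<in> supp x \<union> supp y")
  case False
  then show ?thesis using seg_length_nonneg[of x y] by (simp add: supp_def)
next
  case True
  define S where "S = supp x \<union> supp y"
  have fin: "finite S" using realization_supp(1)[OF assms(1)] assms(2,3) by (simp add: S_def)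
  have one: "sum z S = 1" if "z = x \<or> z = y" for z
  proof -
    have "sum z S = sum z (supp z)"
      by (rule sum.mono_neutral_right) (use that fin in \<open>auto simp: S_def supp_def\<close>)
    then show ?thesis using assms(2,3) that by (auto simp: realization_def)
  qed
  have "(\<Sum>w\<in>S. x w - y w) = 0" using one by (simp add: sum_subtractf)
  moreover have "(\<Sum>w\<in>S. x w - y w) = (x v - y v) + (\<Sum>w\<in>S - {v}. x w - y w)"
    using fin True by (intro sum.remove) (auto simp: S_def)
  ultimately have "x v - y v = - (\<Sum>w\<in>S - {v}. x w - y w)" by simp
  then have "\<bar>x v - y v\<bar> \<le> (\<Sum>w\<in>S - {v}. \<bar>x w - y w\<bar>)"
    using sum_abs[of "\<lambda>w. x w - y w" "S - {v}"] by simp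
  moreover have "(\<Sum>w\<in>S. \<bar>x w - y w\<bar>) = \<bar>x v - y v\<bar> + (\<Sum>w\<in>S - {v}. \<bar>x w - y w\<bar>)"
    using fin True by (intro sum.remove) (auto simp: S_def)
  ultimately show ?thesis by (simp add: seg_length_def S_def)
qed

lemma pl_path_realization:
  "pl_path V E x y l \<Longrightarrow> x \<in> realization V E \<and> y \<in> realization V E"
  by (induction rule: pl_path.induct) auto

lemma pl_path_nonneg: "pl_path V E x y l \<Longrightarrow> l \<ge> 0"
  by (induction rule: pl_path.induct) (auto simp: seg_length_nonneg add_nonneg_nonneg)

lemma pl_path_trans:
  assumes "pl_path V E x y l" "pl_path V E y z m"
  shows "pl_path V E x z (l + m)"
  using assms
proof (induction rule: pl_path.induct)
  case (step x y e w l)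
  then have "pl_path V E x z (seg_length x y + (l + m))" by (intro pl_path.step) auto
  then show ?case by (simp add: add.assoc)
qed auto

lemma pl_path_seg:
  assumes "x \<in> realization V E" "y \<in> realization V E" "e \<in> E" "supp x \<subseteq> e" "supp y \<subseteq> e"
  shows "pl_path V E x y (seg_length x y)"
  using pl_path.step[OF assms pl_path.refl[OF assms(2)]] by simp

lemma pl_path_sym: "pl_path V E x y l \<Longrightarrow> pl_path V E y x l"
proof (induction rule: pl_path.induct)
  case (refl x)
  then show ?case by (rule pl_path.refl)
next
  case (step x y e z l)
  then have "pl_path V E y x (seg_length y x)" by (intro pl_path_seg) auto
  from pl_path_trans[OF step.IH this] show ?case
    by (simp add: seg_length_commute[of x y] add.commute)
qed

lemma coordinate_le_pl_path:
  assumes "simple_graph V E" "pl_path V E x y l"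
  shows "\<bar>x v - y v\<bar> \<le> l"
  using assms(2)
proof (induction rule: pl_path.induct)
  case (step x y e z l)
  then show ?case using coordinate_le_seg_length[OF assms(1), of x y v] by linarith
qed auto

lemma indicator_in_realization: "v \<in> V \<Longrightarrow> indicator {v} \<in> realization V E"
proof -
  assume v: "v \<in> V"
  have "supp (indicator {v} :: 'a \<Rightarrow> real) = {v}" by (auto simp: supp_def indicator_def)
  with v show ?thesis by (auto simp: realization_def)
qed

lemma supp_indicator: "supp (indicator {v}) = {v}"
  by (auto simp: supp_def indicator_def)

lemma pl_path_exists:
  assumes conn: "connected_graph V E" and "x \<in> realization V E" "y \<in> realization V E"
  shows "\<exists>l. pl_path V E x y l"
proof -
  have sg: "simple_graph V E" using conn by (simp add: connected_graph_def)
  have vert: "\<exists>l. pl_path V E (indicator {u}) (indicator {v}) l"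
    if "(u, v) \<in> {(a, b). {a, b} \<in> E}\<^sup>*" "u \<in> V" for u v
    using that
  proof (induction rule: rtrancl_induct)
    case base
    then show ?case by (intro exI[of _ 0] pl_path.refl indicator_in_realization)
  next
    case (step b c)
    then have e: "{b, c} \<in> E" by simp
    then have "b \<in> V" "c \<in> V" using sg by (auto simp: simple_graph_def)
    then have "pl_path V E (indicator {b}) (indicator {c}) (seg_length (indicator {b}) (indicator {c}))"
      by (intro pl_path_seg[OF _ _ e]) (auto simp: indicator_in_realization supp_indicator)
    moreover obtain l where "pl_path V E (indicator {u}) (indicator {b}) l"
      using step.IH step.prems by auto
    ultimately show ?case using pl_path_trans by meson
  qed
  have near: "\<exists>u\<in>V. \<exists>l. pl_path V E z (indicator {u}) l" if z: "z \<in> realization V E" for z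
  proof -
    from z consider v where "v \<in> V" "supp z = {v}" | "supp z \<in> E"
      by (auto simp: realization_def)
    then show ?thesis
    proof cases
      case 1
      have "z v = 1" using z 1 by (simp add: realization_def)
      moreover have "z w = 0" if "w \<noteq> v" for w
        using 1(2) that unfolding supp_def by blast
      ultimately have "z = indicator {v}" by (intro ext) (simp add: indicator_def)
      then show ?thesis using 1 z pl_path.refl by blast
    next
      case 2
      obtain u where "u \<in> supp z" using realization_supp(3)[OF sg z] by auto
      moreover from this have "u \<in> V" using realization_supp(2)[OF sg z] by auto
      ultimately have "pl_path V E z (indicator {u}) (seg_length z (indicator {u}))"
        by (intro pl_path_seg[OF z _ 2]) (auto simp: indicator_in_realization supp_indicator)
      with \<open>u \<in> V\<close> show ?thesis by blast
    qed
  qed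
  obtain u l v m where uv: "u \<in> V" "v \<in> V"
    and *: "pl_path V E x (indicator {u}) l" "pl_path V E y (indicator {v}) m"
    using near[OF assms(2)] near[OF assms(3)] by blast
  obtain k where "pl_path V E (indicator {u}) (indicator {v}) k"
    using vert[of u v] uv conn unfolding connected_graph_def by auto
  from pl_path_trans[OF pl_path_trans[OF *(1) this] pl_path_sym[OF *(2)]]
  show ?thesis by blast
qed

lemma path_dist_le: "pl_path V E x y l \<Longrightarrow> path_dist V E x y \<le> l"
  unfolding path_dist_def
  by (auto intro!: cInf_lower bdd_belowI[of _ 0] dest: pl_path_nonneg)

lemma le_path_dist:
  assumes "connected_graph V E" "x \<in> realization V E" "y \<in> realization V E"
    and "\<And>l. pl_path V E x y l \<Longrightarrow> b \<le> l"
  shows "b \<le> path_dist V E x y"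
  using pl_path_exists[OF assms(1-3)] assms(4)
  by (auto simp: path_dist_def intro!: cInf_greatest)

theorem Metric_space_path_dist:
  assumes conn: "connected_graph V E"
  shows "Metric_space (realization V E) (path_dist V E)"
proof
  have sg: "simple_graph V E" using conn by (simp add: connected_graph_def)
  fix x y
  show "0 \<le> path_dist V E x y"
    unfolding path_dist_def by (auto intro!: cInf_greatest dest: pl_path_nonneg)
  show "path_dist V E x y = path_dist V E y x"
  proof -
    have "pl_path V E x y = pl_path V E y x" using pl_path_sym by blast
    then show ?thesis by (simp add: path_dist_def)
  qed
  assume x: "x \<in> realization V E" and y: "y \<in> realization V E"
  show "path_dist V E x y = 0 \<longleftrightarrow> x = y"
  proof
    assume 0: "path_dist V E x y = 0"
    show "x = y"
    proof
      fix v
      have "\<bar>x v - y v\<bar> \<le> path_dist V E x y"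
        using le_path_dist[OF conn x y] coordinate_le_pl_path[OF sg] by blast
      with 0 show "x v = y v" by simp
    qed
  next
    assume "x = y"
    then have "path_dist V E x y \<le> 0" using path_dist_le[OF pl_path.refl[OF x]] by simp
    moreover have "0 \<le> path_dist V E x y"
      using le_path_dist[OF conn x y] pl_path_nonneg by blast
    ultimately show "path_dist V E x y = 0" by simp
  qed
  fix z assume z: "z \<in> realization V E"
  have *: "path_dist V E x z - m \<le> path_dist V E x y" if m: "pl_path V E y z m" for m
  proof (rule le_path_dist[OF conn x y])
    fix l assume "pl_path V E x y l"
    from path_dist_le[OF pl_path_trans[OF this m]] show "path_dist V E x z - m \<le> l" by simp
  qed
  have "path_dist V E x z - path_dist V E x y \<le> path_dist V E y z"
  proof (rule le_path_dist[OF conn y z])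
    fix m assume "pl_path V E y z m"
    from *[OF this] show "path_dist V E x z - path_dist V E x y \<le> m" by simp
  qed
  then show "path_dist V E x z \<le> path_dist V E x y + path_dist V E y z" by simp
qed

lemma path_dist_edge:
  assumes "connected_graph V E" "{u, v} \<in> E"
  shows "path_dist V E (indicator {u}) (indicator {v}) = 1"
proof -
  have sg: "simple_graph V E" using assms(1) by (simp add: connected_graph_def)
  with assms(2) have uv: "u \<in> V" "v \<in> V" "u \<noteq> v"
    by (auto simp: simple_graph_def card_insert_if split: if_splits)
  note r = indicator_in_realization[OF uv(1), of E] indicator_in_realization[OF uv(2), of E]
  have "pl_path V E (indicator {u}) (indicator {v}) (seg_length (indicator {u}) (indicator {v}))"
    by (intro pl_path_seg[OF r assms(2)]) (auto simp: supp_indicator)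
  moreover have "seg_length (indicator {u}) (indicator {v}) = 1"
    using uv(3) by (simp add: seg_length_def supp_indicator)
  ultimately have "path_dist V E (indicator {u}) (indicator {v}) \<le> 1"
    using path_dist_le by metis
  moreover have "1 \<le> path_dist V E (indicator {u}) (indicator {v})"
  proof (rule le_path_dist[OF assms(1) r])
    fix l assume "pl_path V E (indicator {u}) (indicator {v}) l"
    from coordinate_le_pl_path[OF sg this, of u] show "1 \<le> l" using uv(3) by simp
  qed
  ultimately show ?thesis by simp
qed

end

theory Submission
  imports Defs
begin

text \<open>Write \<open>\<rho>\<close> for the distance of \<open>X\<close> transported to the vertices of the given cactus \<open>P\<close> by a
  quasi-inverse, and fix a root \<open>r\<close>. Let \<open>H v\<close> be the least \<open>t\<close> such that \<open>v\<close> can be reached from \<open>r\<close> in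
  \<open>P\<close> without leaving the ball of radius \<open>t\<close>; it agrees with \<open>\<rho> r v\<close> up to a constant and increases
  along the branches of a suitable spanning tree. That \<open>P\<close> is a cactus means that each subtree is left
  by at most one of the edges outside the tree. Give every tree edge the difference of heights of its
  ends as its new length, contracting or subdividing it, and every other edge length 1. The result is a
  cactus \<open>Q\<close>, in which distances to the root are exactly the heights, so that errors do not accumulate
  along the branches. For arbitrary \<open>u\<close> and \<open>v\<close>, a coarse geodesic either passes near a common ancestor or
  uses an edge \<open>{a, b}\<close> outside the tree, and then passes near a common ancestor of \<open>u\<close>
  and \<open>a\<close> and one of \<open>v\<close> and \<open>b\<close>. This holds both for \<open>\<rho>\<close> and for the path metric of \<open>Q\<close>, and in either
  case the distance is determined by the heights up to a constant.\<close>

section \<open>Points and paths in the realization of a graph\<close>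

lemma sum_realization:
  assumes "x \<in> realization V E" "finite A" "supp x \<subseteq> A"
  shows "sum x A = 1"
proof -
  have "sum x A = sum x (supp x)"
    by (rule sum.mono_neutral_right) (use assms in \<open>auto simp: supp_def\<close>)
  then show ?thesis using assms(1) by (simp add: realization_def)
qed

lemma seg_length_le_1:
  assumes "simple_graph V E" "x \<in> realization V E" "y \<in> realization V E"
  shows "seg_length x y \<le> 1"
proof -
  define A where "A = supp x \<union> supp y"
  have fin: "finite A" using realization_supp(1) assms unfolding A_def by blast
  have nonneg: "0 \<le> x v" "0 \<le> y v" for v using assms by (auto simp: realization_def)
  have "(\<Sum>v\<in>A. \<bar>x v - y v\<bar>) \<le> (\<Sum>v\<in>A. x v + y v)"
    by (rule sum_mono) (use nonneg in \<open>auto simp: abs_le_iff add_increasing\<close>)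
  also have "\<dots> = 2"
    using sum_realization[OF assms(2) fin] sum_realization[OF assms(3) fin]
    by (simp add: sum.distrib A_def)
  finally show ?thesis by (simp add: seg_length_def A_def)
qed

lemma pl_path_supp:
  assumes sg: "simple_graph V E" and x: "x \<in> realization V E" and p: "p \<in> supp x"
  shows "\<exists>l\<le>1. pl_path V E x (indicator {p}) l"
proof -
  have pV: "p \<in> V" using realization_supp(2)[OF sg x] p by auto
  from x consider v where "v \<in> V" "supp x = {v}" | "supp x \<in> E"
    by (auto simp: realization_def)
  then show ?thesis
  proof cases
    case 1
    then have v: "supp x = {p}" using p by auto
    have "x = indicator {p}"
    proof
      fix w show "x w = indicator {p} w"
      proof (cases "w = p")
        case True
        then show ?thesis using x v by (simp add: realization_def)
      next
        case False
        then have "w \<notin> supp x" using v by auto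
        then show ?thesis using False by (simp add: supp_def)
      qed
    qed
    then show ?thesis using pl_path.refl[OF x] by (intro exI[of _ 0]) auto
  next
    case 2
    show ?thesis
      using seg_length_le_1[OF sg x indicator_in_realization[OF pV]]
        pl_path_seg[OF x indicator_in_realization[OF pV] 2] p
      by (auto simp: supp_indicator)
  qed
qed

lemma path_dist_supp:
  assumes "simple_graph V E" "x \<in> realization V E" "p \<in> supp x"
  shows "path_dist V E x (indicator {p}) \<le> 1"
  using pl_path_supp[OF assms] path_dist_le by fastforce

lemma pl_path_near:
  assumes "connected_graph V E" "x \<in> realization V E" "y \<in> realization V E"
    "path_dist V E x y \<le> b"
  shows "\<exists>l\<le>b + 1. pl_path V E x y l"
proof (rule ccontr)
  assume "\<not> ?thesis"
  then have "b + 1 \<le> path_dist V E x y"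
    by (intro le_path_dist[OF assms(1-3)]) (meson linorder_le_cases)
  with assms(4) show False by simp
qed

definition induced :: "'v set set \<Rightarrow> 'v set \<Rightarrow> ('v \<times> 'v) set" where
  "induced E W = {(a, b). {a, b} \<in> E \<and> a \<in> W \<and> b \<in> W}"

lemma induced_mono: "W \<subseteq> W' \<Longrightarrow> (induced E W)\<^sup>* \<subseteq> (induced E W')\<^sup>*"
  by (rule rtrancl_mono) (auto simp: induced_def)

lemma pl_path_induced:
  assumes sg: "simple_graph V E" and "pl_path V E x z l" "p \<in> supp x" "q \<in> supp z"
  shows "(p, q) \<in> (induced E
    {w \<in> V. \<exists>k m. pl_path V E x (indicator {w}) k \<and> pl_path V E (indicator {w}) z m \<and> k + m \<le> l + 2})\<^sup>*"
    (is "_ \<in> (induced E (?W x z l))\<^sup>*")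
  using assms(2-4)
proof (induction arbitrary: p rule: pl_path.induct)
  case (refl x)
  have mem: "w \<in> ?W x x 0" if w: "w \<in> supp x" for w
  proof -
    obtain k where "k \<le> 1" "pl_path V E x (indicator {w}) k"
      using pl_path_supp[OF sg refl.hyps w] by blast
    then show ?thesis using pl_path_sym[of V E x "indicator {w}" k] realization_supp(2)[OF sg refl.hyps] w
      by (auto intro!: exI[of _ k])
  qed
  show ?case
  proof (cases "p = q")
    case False
    have "supp x \<in> E" using refl False by (auto simp: realization_def)
    moreover from this have "card (supp x) = 2" using sg by (auto simp: simple_graph_def)
    ultimately have "{p, q} \<in> E" using refl.prems False
      by (metis card_2_iff doubleton_eq_iff empty_iff insert_iff)
    then have "(p, q) \<in> induced E (?W x x 0)" unfolding induced_def
      using mem refl.prems by blast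
    then show ?thesis by blast
  qed auto
next
  case (step x y e z l)
  obtain p' where p': "p' \<in> supp y" using realization_supp(3)[OF sg step.hyps(2)] by auto
  have V: "p \<in> V" "p' \<in> V" using realization_supp(2)[OF sg] step.hyps step.prems p' by blast+
  have xy: "pl_path V E x y (seg_length x y)" by (rule pl_path_seg) (use step.hyps in auto)
  have sub: "?W y z l \<subseteq> ?W x z (seg_length x y + l)"
  proof
    fix w assume "w \<in> ?W y z l"
    then obtain k m where *: "w \<in> V" "pl_path V E y (indicator {w}) k"
      "pl_path V E (indicator {w}) z m" "k + m \<le> l + 2" by blast
    have "pl_path V E x (indicator {w}) (seg_length x y + k)" by (rule pl_path_trans[OF xy *(2)])
    moreover have "seg_length x y + k + m \<le> seg_length x y + l + 2" using *(4) by simp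
    ultimately show "w \<in> ?W x z (seg_length x y + l)" using *(1,3) by blast
  qed
  have "p' \<in> ?W y z l"
  proof -
    obtain k where k: "k \<le> 1" "pl_path V E y (indicator {p'}) k"
      using pl_path_supp[OF sg step.hyps(2) p'] by blast
    have "k + (k + l) \<le> l + 2" using k(1) by simp
    then show ?thesis using pl_path_trans[OF pl_path_sym[OF k(2)] step.hyps(6)] k(2) V by blast
  qed
  moreover have "p \<in> ?W x z (seg_length x y + l)"
  proof -
    obtain k where k: "k \<le> 1" "pl_path V E x (indicator {p}) k"
      using pl_path_supp[OF sg step.hyps(1)] step.prems by blast
    have "k + (k + (seg_length x y + l)) \<le> seg_length x y + l + 2" using k(1) by simp
    then show ?thesis
      using pl_path_trans[OF pl_path_sym[OF k(2)] pl_path_trans[OF xy step.hyps(6)]] k(2) V by blast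
  qed
  moreover have "p = p' \<or> {p, p'} \<in> E"
  proof -
    have "card e = 2" using sg step.hyps(3) by (auto simp: simple_graph_def)
    then show ?thesis using step.hyps(3-5) step.prems(1) p'
      by (metis card_2_iff doubleton_eq_iff insertE singletonD subsetD)
  qed
  ultimately have "p = p' \<or> (p, p') \<in> induced E (?W x z (seg_length x y + l))"
    using sub unfolding induced_def by blast
  then have "(p, p') \<in> (induced E (?W x z (seg_length x y + l)))\<^sup>*" by blast
  also have "(p', q) \<in> (induced E (?W x z (seg_length x y + l)))\<^sup>*"
    using step.IH[OF p' step.prems(2)] induced_mono[OF sub] by blast
  finally show ?case .
qed

lemma path_dist_induced:
  assumes conn: "connected_graph V E" and x: "x \<in> realization V E" and z: "z \<in> realization V E"
    and "path_dist V E x z \<le> b" "p \<in> supp x" "q \<in> supp z"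
  shows "(p, q) \<in> (induced E
    {w \<in> V. path_dist V E x (indicator {w}) + path_dist V E (indicator {w}) z \<le> b + 3})\<^sup>*"
proof -
  have sg: "simple_graph V E" using conn by (simp add: connected_graph_def)
  obtain l where l: "l \<le> b + 1" "pl_path V E x z l"
    using pl_path_near[OF conn x z assms(4)] by blast
  have "{w \<in> V. \<exists>k m. pl_path V E x (indicator {w}) k \<and> pl_path V E (indicator {w}) z m \<and> k + m \<le> l + 2}
    \<subseteq> {w \<in> V. path_dist V E x (indicator {w}) + path_dist V E (indicator {w}) z \<le> b + 3}"
  proof clarify
    fix w k m assume *: "pl_path V E x (indicator {w}) k" "pl_path V E (indicator {w}) z m" "k + m \<le> l + 2"
    show "path_dist V E x (indicator {w}) + path_dist V E (indicator {w}) z \<le> b + 3"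
      using path_dist_le[OF *(1)] path_dist_le[OF *(2)] *(3) l(1) by linarith
  qed
  from subsetD[OF induced_mono[OF this] pl_path_induced[OF sg l(2) assms(5,6)]] show ?thesis .
qed

lemma path_dist_height:
  fixes \<phi> :: "'v \<Rightarrow> real"
  assumes conn: "connected_graph V E" and V: "u \<in> V" "v \<in> V"
    and lip: "\<And>a b. {a, b} \<in> E \<Longrightarrow> \<bar>\<phi> a - \<phi> b\<bar> \<le> 1"
  shows "\<bar>\<phi> u - \<phi> v\<bar> \<le> path_dist V E (indicator {u}) (indicator {v})"
proof -
  have sg: "simple_graph V E" using conn by (simp add: connected_graph_def)
  define \<psi> where "\<psi> x = (\<Sum>v\<in>supp x. x v * \<phi> v)" for x
  have seg: "\<bar>\<psi> x - \<psi> y\<bar> \<le> seg_length x y"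
    if xy: "x \<in> realization V E" "y \<in> realization V E" "e \<in> E" "supp x \<subseteq> e" "supp y \<subseteq> e" for x y e
  proof -
    obtain p q where e: "e = {p, q}" "p \<noteq> q"
      using sg xy(3) by (auto simp: simple_graph_def card_2_iff)
    have \<psi>: "\<psi> z = z p * \<phi> p + z q * \<phi> q" "z p + z q = 1"
      if z: "z \<in> realization V E" "supp z \<subseteq> e" for z
    proof -
      have "\<psi> z = (\<Sum>v\<in>e. z v * \<phi> v)" unfolding \<psi>_def
        by (rule sum.mono_neutral_left) (use z e in \<open>auto simp: supp_def\<close>)
      then show "\<psi> z = z p * \<phi> p + z q * \<phi> q" using e by simp
      show "z p + z q = 1" using sum_realization[OF z(1) _ z(2)] e by simp
    qed
    have "2 * seg_length x y = (\<Sum>v\<in>e. \<bar>x v - y v\<bar>)"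
      unfolding seg_length_def
      by simp (rule sum.mono_neutral_left, use xy e in \<open>auto simp: supp_def\<close>)
    also have "\<dots> = 2 * \<bar>x p - y p\<bar>"
      using \<psi>(2)[OF xy(1,4)] \<psi>(2)[OF xy(2,5)] e by (simp add: algebra_simps abs_if)
    finally have s: "seg_length x y = \<bar>x p - y p\<bar>" by simp
    have q: "x q = 1 - x p" "y q = 1 - y p" using \<psi>(2)[OF xy(1,4)] \<psi>(2)[OF xy(2,5)] by auto
    have "\<psi> x - \<psi> y = (x p - y p) * (\<phi> p - \<phi> q)"
      unfolding \<psi>(1)[OF xy(1,4)] \<psi>(1)[OF xy(2,5)] q by (simp add: algebra_simps)
    then have "\<bar>\<psi> x - \<psi> y\<bar> = \<bar>x p - y p\<bar> * \<bar>\<phi> p - \<phi> q\<bar>" by (simp add: abs_mult)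
    also have "\<dots> \<le> \<bar>x p - y p\<bar>" using lip[of p q] xy(3) e by (simp add: mult_left_le)
    finally show ?thesis using s by simp
  qed
  have "\<bar>\<psi> x - \<psi> z\<bar> \<le> l" if "pl_path V E x z l" for x z l
    using that
  proof (induction rule: pl_path.induct)
    case (step x y e z l)
    then show ?case using seg[of x y e] by linarith
  qed auto
  then have "\<bar>\<psi> (indicator {u}) - \<psi> (indicator {v})\<bar> \<le> path_dist V E (indicator {u}) (indicator {v})"
    by (intro le_path_dist[OF conn] indicator_in_realization V)
  then show ?thesis by (simp add: \<psi>_def supp_indicator)
qed

section \<open>Simple cycles\<close>

lemma mod_add_cancel_left: "(k + a) mod n = (k + b) mod n \<longleftrightarrow> a mod n = b mod n" for k a b n :: nat
proof -
  have "int ((k + a) mod n) = int ((k + b) mod n) \<longleftrightarrow> int (a mod n) = int (b mod n)"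
    by (simp add: zmod_int mod_eq_dvd_iff)
  then show ?thesis by (simp only: of_nat_eq_iff)
qed

definition crosses :: "'v set \<Rightarrow> 'v set \<Rightarrow> bool" where
  "crosses A f \<longleftrightarrow> (\<exists>x y. f = {x, y} \<and> x \<in> A \<and> y \<notin> A)"

lemma Suc_Suc_mod_neq: "3 \<le> n \<Longrightarrow> Suc (Suc k) mod n \<noteq> k mod n"
  using mod_add_cancel_left[of k 2 n 0] by simp

lemma cycle_edges_nth_mod:
  assumes "c \<noteq> []"
  shows "cycle_edges c = range (\<lambda>k. {c ! (k mod length c), c ! (Suc k mod length c)})"
proof
  show "cycle_edges c \<subseteq> range (\<lambda>k. {c ! (k mod length c), c ! (Suc k mod length c)})"
  proof
    fix f assume "f \<in> cycle_edges c"
    then obtain i where "i < length c" "f = {c ! i, c ! (Suc i mod length c)}"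
      by (auto simp: cycle_edges_def)
    then have "f = {c ! (i mod length c), c ! (Suc i mod length c)}" by simp
    then show "f \<in> range (\<lambda>k. {c ! (k mod length c), c ! (Suc k mod length c)})" by (rule range_eqI)
  qed
  show "range (\<lambda>k. {c ! (k mod length c), c ! (Suc k mod length c)}) \<subseteq> cycle_edges c"
  proof clarify
    fix k
    have "Suc k mod length c = Suc (k mod length c) mod length c" by (simp add: mod_Suc_eq)
    moreover have "k mod length c < length c" using assms by simp
    ultimately show "{c ! (k mod length c), c ! (Suc k mod length c)} \<in> cycle_edges c"
      unfolding cycle_edges_def by auto
  qed
qed

lemma set_nth_mod: "c \<noteq> [] \<Longrightarrow> x \<in> set c \<longleftrightarrow> (\<exists>k\<ge>m. x = c ! (k mod length c))"
proof
  assume "c \<noteq> []" "x \<in> set c"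
  then obtain i where "i < length c" "x = c ! i" by (auto simp: in_set_conv_nth)
  moreover have "i + m * length c \<ge> m" using \<open>c \<noteq> []\<close>
    by (cases c) auto
  ultimately show "\<exists>k\<ge>m. x = c ! (k mod length c)" by (metis mod_less mod_mult_self1)
qed auto

lemma nth_mod_eq_iff:
  "distinct c \<Longrightarrow> c \<noteq> [] \<Longrightarrow>
    c ! (i mod length c) = c ! (j mod length c) \<longleftrightarrow> i mod length c = j mod length c"
  by (simp add: nth_eq_iff_index_eq)

lemma exit_time:
  assumes "i \<le> (j :: nat)" "\<phi> i \<in> A" "\<phi> j \<notin> A"
  shows "\<exists>k. i \<le> k \<and> k < j \<and> \<phi> k \<in> A \<and> \<phi> (Suc k) \<notin> A"
  using assms(1,3)
proof (induction j rule: dec_induct)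
  case base
  then show ?case using assms(2) by simp
next
  case (step j)
  then show ?case by (metis less_Suc_eq)
qed

lemma simple_cycle_crosses_twice:
  assumes "simple_cycle V E c" "x \<in> set c" "x \<in> A" "y \<in> set c" "y \<notin> A"
  shows "\<exists>f\<in>cycle_edges c. \<exists>f'\<in>cycle_edges c. f \<noteq> f' \<and> crosses A f \<and> crosses A f'"
proof -
  define n where "n = length c"
  have c: "3 \<le> n" "distinct c" "c \<noteq> []" using assms(1) by (auto simp: simple_cycle_def n_def)
  define \<phi> where "\<phi> k = c ! (k mod n)" for k
  have edges: "{\<phi> k, \<phi> (Suc k)} \<in> cycle_edges c" for k
    unfolding cycle_edges_nth_mod[OF c(3)] \<phi>_def n_def by (rule rangeI)
  have eq: "\<phi> i = \<phi> j \<longleftrightarrow> i mod n = j mod n" for i j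
    unfolding \<phi>_def n_def by (rule nth_mod_eq_iff[OF c(2,3)])
  have visit: "\<exists>k\<ge>m. \<phi> k = w" if "w \<in> set c" for w m
    using set_nth_mod[OF c(3), of w m] that unfolding \<phi>_def n_def by auto
  obtain i where i: "\<phi> i = x" using visit[OF assms(2)] by blast
  obtain j where j: "i \<le> j" "\<phi> j = y" using visit[OF assms(4)] by blast
  obtain i' where i': "j \<le> i'" "\<phi> i' = x" using visit[OF assms(2)] by blast
  obtain k where k: "\<phi> k \<in> A" "\<phi> (Suc k) \<notin> A" using exit_time[of i j \<phi> A] j(1) assms(3,5) unfolding i(1) j(2) by blast
  obtain k' where k': "\<phi> k' \<notin> A" "\<phi> (Suc k') \<in> A" using exit_time[of j i' \<phi> "- A"] i'(1) assms(3,5) unfolding i'(2) j(2) by blast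
  have "{\<phi> k, \<phi> (Suc k)} \<noteq> {\<phi> k', \<phi> (Suc k')}"
  proof
    assume "{\<phi> k, \<phi> (Suc k)} = {\<phi> k', \<phi> (Suc k')}"
    then have "\<phi> k = \<phi> (Suc k')" "\<phi> (Suc k) = \<phi> k'" using k k' unfolding doubleton_eq_iff by metis+
    then have *: "k mod n = Suc k' mod n" "Suc k mod n = k' mod n" unfolding eq by blast+
    have "Suc (Suc k) mod n = Suc (Suc k mod n) mod n" by (simp only: mod_Suc_eq)
    also have "\<dots> = k mod n" unfolding * by (simp only: mod_Suc_eq)
    finally show False using Suc_Suc_mod_neq[OF c(1), of k] by blast
  qed
  moreover have "crosses A {\<phi> k, \<phi> (Suc k)}" unfolding crosses_def using k by blast
  moreover have "crosses A {\<phi> k', \<phi> (Suc k')}" unfolding crosses_def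
    by (intro exI[of _ "\<phi> (Suc k')"] exI[of _ "\<phi> k'"] conjI insert_commute k')
  ultimately show ?thesis by (intro bexI[OF _ edges[of k]] bexI[OF _ edges[of k']] conjI)
qed

lemma cycle_edge_subset:
  assumes "f \<in> cycle_edges c"
  shows "f \<subseteq> set c"
proof -
  obtain i where "i < length c" "f = {c ! i, c ! (Suc i mod length c)}"
    using assms by (auto simp: cycle_edges_def)
  moreover from this have "Suc i mod length c < length c" by (intro mod_less_divisor) auto
  ultimately show ?thesis by auto
qed

lemma simple_cycle_crosses_other:
  assumes "simple_cycle V E c" "f \<in> cycle_edges c" "crosses A f"
  shows "\<exists>f'\<in>cycle_edges c. f' \<noteq> f \<and> crosses A f'"
proof -
  have "f \<subseteq> set c" by (rule cycle_edge_subset[OF assms(2)])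
  moreover obtain x y where "f = {x, y}" "x \<in> A" "y \<notin> A"
    using assms(3) unfolding crosses_def by blast
  ultimately obtain f1 f2 where "f1 \<in> cycle_edges c" "f2 \<in> cycle_edges c" "f1 \<noteq> f2"
    "crosses A f1" "crosses A f2"
    using simple_cycle_crosses_twice[OF assms(1), of x A y] by blast
  then show ?thesis by metis
qed

lemma simple_cycle_minimal:
  assumes c: "simple_cycle V E c" and c': "simple_cycle V E c'"
    and sub: "cycle_edges c \<subseteq> cycle_edges c'"
  shows "cycle_edges c = cycle_edges c'"
proof -
  define n m where "n = length c" and "m = length c'"
  have n: "3 \<le> n" "distinct c" "c \<noteq> []" using c by (auto simp: simple_cycle_def n_def)
  have m: "3 \<le> m" "distinct c'" "c' \<noteq> []" using c' by (auto simp: simple_cycle_def m_def)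
  define \<phi> \<psi> where "\<phi> k = c ! (k mod n)" and "\<psi> k = c' ! (k mod m)" for k
  have ce: "cycle_edges c = range (\<lambda>k. {\<phi> k, \<phi> (Suc k)})"
    "cycle_edges c' = range (\<lambda>k. {\<psi> k, \<psi> (Suc k)})"
    unfolding \<phi>_def \<psi>_def n_def m_def using cycle_edges_nth_mod[OF n(3)] cycle_edges_nth_mod[OF m(3)] .
  have eq: "\<phi> i = \<phi> j \<longleftrightarrow> i mod n = j mod n" "\<psi> i = \<psi> j \<longleftrightarrow> i mod m = j mod m" for i j
    unfolding \<phi>_def n_def \<psi>_def m_def
    by (rule nth_mod_eq_iff[OF n(2,3)], rule nth_mod_eq_iff[OF m(2,3)])
  have succ: "{\<psi> (Suc k), \<psi> (Suc (Suc k))} \<in> cycle_edges c"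
    if k: "{\<psi> k, \<psi> (Suc k)} \<in> cycle_edges c" for k
  proof -
    obtain i0 where "\<psi> (Suc k) = \<phi> i0" using k unfolding ce(1) by (auto simp: doubleton_eq_iff)
    moreover have "\<phi> i0 = \<phi> (Suc (i0 + n - 1))" using n(1) by (simp add: eq)
    ultimately obtain i where i: "\<psi> (Suc k) = \<phi> (Suc i)" by metis
    have ne: "\<phi> i \<noteq> \<phi> (Suc (Suc i))"
      unfolding eq using Suc_Suc_mod_neq[OF n(1), of i] by metis
    have nb: "w = \<psi> k \<or> w = \<psi> (Suc (Suc k))" if "{\<psi> (Suc k), w} \<in> cycle_edges c'" for w
    proof -
      from that obtain j where "{\<psi> (Suc k), w} = {\<psi> j, \<psi> (Suc j)}" unfolding ce by blast
      then consider "\<psi> (Suc k) = \<psi> j" "w = \<psi> (Suc j)" | "\<psi> (Suc k) = \<psi> (Suc j)" "w = \<psi> j"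
        by (auto simp: doubleton_eq_iff)
      then show ?thesis
      proof cases
        case 1
        then have "\<psi> (Suc j) = \<psi> (Suc (Suc k))" by (metis eq(2) mod_Suc_eq)
        then show ?thesis using 1 by simp
      next
        case 2
        then have "k mod m = j mod m" unfolding eq using mod_add_cancel_left[of 1 k m j] by simp
        then show ?thesis using 2 eq(2) by metis
      qed
    qed
    have e1: "{\<psi> (Suc k), \<phi> i} \<in> cycle_edges c" unfolding i ce(1) by (subst insert_commute) (rule rangeI)
    have e2: "{\<psi> (Suc k), \<phi> (Suc (Suc i))} \<in> cycle_edges c" unfolding i ce(1) by (rule rangeI)
    show ?thesis using nb[of "\<phi> i"] nb[of "\<phi> (Suc (Suc i))"] e1 e2 sub ne by (metis subsetD)
  qed
  have "{\<phi> 0, \<phi> (Suc 0)} \<in> cycle_edges c" unfolding ce(1) by (rule rangeI)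
  moreover from this have "{\<phi> 0, \<phi> (Suc 0)} \<in> range (\<lambda>k. {\<psi> k, \<psi> (Suc k)})"
    using sub unfolding ce(2) by (rule rev_subsetD)
  then obtain k0 where "{\<phi> 0, \<phi> (Suc 0)} = {\<psi> k0, \<psi> (Suc k0)}" by (rule imageE)
  ultimately have k0: "{\<psi> k0, \<psi> (Suc k0)} \<in> cycle_edges c" by simp
  have all: "{\<psi> k, \<psi> (Suc k)} \<in> cycle_edges c" if "k0 \<le> k" for k
    using that
  proof (induction k rule: dec_induct)
    case base
    show ?case by (rule k0)
  next
    case (step k)
    show ?case by (rule succ[OF step.IH])
  qed
  have "{\<psi> k, \<psi> (Suc k)} \<in> cycle_edges c" for k
  proof -
    have "\<psi> (k + k0 * m) = \<psi> k" "\<psi> (Suc (k + k0 * m)) = \<psi> (Suc k)"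
      unfolding eq using mod_mult_self1[of k k0 m] mod_mult_self1[of "Suc k" k0 m] by simp_all
    moreover have "k0 \<le> k + k0 * m" using m(1) by (simp add: trans_le_add2)
    ultimately show ?thesis using all[of "k + k0 * m"] by simp
  qed
  then have "cycle_edges c' \<subseteq> cycle_edges c" unfolding ce(2) by (intro image_subsetI)
  then show ?thesis using sub by (intro equalityI)
qed

lemma rtrancl_distinct_path:
  assumes "(u, v) \<in> R\<^sup>*"
  shows "\<exists>p. distinct p \<and> p \<noteq> [] \<and> hd p = u \<and> last p = v \<and> successively (\<lambda>x y. (x, y) \<in> R) p"
  using assms
proof (induction rule: rtrancl_induct)
  case base
  show ?case by (rule exI[of _ "[u]"]) auto
next
  case (step v w)
  then obtain p where p: "distinct p" "p \<noteq> []" "hd p = u" "last p = v"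
    "successively (\<lambda>x y. (x, y) \<in> R) p" by blast
  show ?case
  proof (cases "w \<in> set p")
    case True
    then obtain xs ys where "p = xs @ w # ys" by (meson split_list)
    then show ?thesis using p
      by (intro exI[of _ "xs @ [w]"]) (cases xs, auto simp: successively_append_iff successively_Cons hd_append)
  next
    case False
    then show ?thesis using p step.hyps(2)
      by (intro exI[of _ "p @ [w]"]) (auto simp: successively_append_iff)
  qed
qed

section \<open>Rooted spanning trees with extra edges\<close>

locale rooted_tree =
  fixes V :: "'n set" and r :: 'n and par :: "'n \<Rightarrow> 'n" and S :: "'n set set"
  assumes root_in: "r \<in> V" and par_root: "par r = r"
    and par_in: "v \<in> V \<Longrightarrow> par v \<in> V"
    and reach_root: "v \<in> V \<Longrightarrow> \<exists>k. (par ^^ k) v = r"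
    and extra: "e \<in> S \<Longrightarrow> \<exists>a b. e = {a, b} \<and> a \<in> V \<and> b \<in> V \<and> a \<noteq> b \<and> b \<noteq> par a \<and> a \<noteq> par b"
begin

definition anc :: "'n \<Rightarrow> 'n \<Rightarrow> bool" where
  "anc a v \<longleftrightarrow> (\<exists>k. (par ^^ k) v = a)"

abbreviation sub :: "'n \<Rightarrow> 'n set" where
  "sub a \<equiv> {v. anc a v}"

definition tree_edges :: "'n set set" where
  "tree_edges = (\<lambda>n. {n, par n}) ` (V - {r})"

definition edges :: "'n set set" where
  "edges = tree_edges \<union> S"

lemma funpow_par_root [simp]: "(par ^^ k) r = r"
  by (induction k) (auto simp: par_root)

lemma funpow_par_in: "v \<in> V \<Longrightarrow> (par ^^ k) v \<in> V"
  by (induction k) (auto simp: par_in)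

lemma anc_refl [simp]: "anc v v"
  unfolding anc_def by (rule exI[of _ 0]) simp

lemma anc_par [simp]: "anc (par v) v"
  unfolding anc_def by (rule exI[of _ 1]) simp

lemma anc_funpow [simp]: "anc ((par ^^ k) v) v"
  unfolding anc_def by blast

lemma anc_trans: "anc a b \<Longrightarrow> anc b c \<Longrightarrow> anc a c"
  unfolding anc_def by (metis comp_apply funpow_add)

lemma anc_in: "anc a v \<Longrightarrow> v \<in> V \<Longrightarrow> a \<in> V"
  unfolding anc_def using funpow_par_in by blast

lemma anc_root: "v \<in> V \<Longrightarrow> anc r v"
  unfolding anc_def using reach_root by blast

lemma anc_parD: "anc a v \<Longrightarrow> a \<noteq> v \<Longrightarrow> anc a (par v)"
proof -
  assume "anc a v" "a \<noteq> v"
  then obtain k where k: "(par ^^ k) v = a" unfolding anc_def by blast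
  with \<open>a \<noteq> v\<close> obtain m where "k = Suc m" by (cases k) auto
  with k have "(par ^^ m) (par v) = a" by (simp add: funpow_swap1)
  then show ?thesis unfolding anc_def by blast
qed

lemma anc_le_funpow: "k \<le> m \<Longrightarrow> anc ((par ^^ m) v) ((par ^^ k) v)"
  using anc_funpow[of "m - k" "(par ^^ k) v"] funpow_add[of "m - k" k par] by simp

lemma anc_linear: "anc a v \<Longrightarrow> anc b v \<Longrightarrow> anc a b \<or> anc b a"
  using anc_le_funpow linear unfolding anc_def[of _ v] by metis

lemma anc_of_root: "anc a r \<Longrightarrow> a = r"
  unfolding anc_def by auto

lemma anc_antisym:
  assumes "v \<in> V" "anc a v" "anc v a"
  shows "a = v"
proof (rule ccontr)
  assume "a \<noteq> v"
  obtain k where k: "(par ^^ k) v = a" using assms(2) anc_def by blast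
  obtain m where m: "(par ^^ m) a = v" using assms(3) anc_def by blast
  have cyc: "(par ^^ (m + k)) v = v" using k m by (simp add: funpow_add)
  have "k \<noteq> 0" using k \<open>a \<noteq> v\<close> by (cases k) auto
  have mult: "(par ^^ (j * (m + k))) v = v" for j
    by (induction j) (use cyc in \<open>auto simp: funpow_add\<close>)
  obtain l where l: "(par ^^ l) v = r" using reach_root assms(1) by blast
  have "l \<le> l * (m + k)" using \<open>k \<noteq> 0\<close> by simp
  then have "anc v ((par ^^ l) v)" using anc_le_funpow[of l "l * (m + k)" v] mult by simp
  then have "v = r" using l anc_of_root by simp
  then show False using k \<open>a \<noteq> v\<close> by simp
qed

lemma par_neq: "v \<in> V \<Longrightarrow> v \<noteq> r \<Longrightarrow> par v \<noteq> v"
proof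
  assume "v \<in> V" "v \<noteq> r" "par v = v"
  then have "(par ^^ k) v = v" for k by (induction k) auto
  then show False using reach_root \<open>v \<in> V\<close> \<open>v \<noteq> r\<close> by metis
qed

lemma not_anc_par: "v \<in> V \<Longrightarrow> v \<noteq> r \<Longrightarrow> \<not> anc v (par v)"
  using anc_antisym[of v "par v"] par_neq by auto

lemma siblings: "n \<in> V \<Longrightarrow> m \<in> V \<Longrightarrow> par n = par m \<Longrightarrow> n \<noteq> par n \<Longrightarrow> m \<noteq> par m \<Longrightarrow>
    anc n v \<Longrightarrow> anc m v \<Longrightarrow> n = m"
  by (metis anc_linear anc_parD not_anc_par par_root)

definition lca :: "'n \<Rightarrow> 'n \<Rightarrow> 'n" where
  "lca u v = (par ^^ (LEAST k. anc ((par ^^ k) u) v)) u"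

lemma lca:
  assumes "u \<in> V" "v \<in> V"
  shows "anc (lca u v) u" "anc (lca u v) v" "anc w u \<Longrightarrow> anc w v \<Longrightarrow> anc w (lca u v)"
proof -
  obtain k where "(par ^^ k) u = r" using reach_root assms(1) by blast
  then have "anc ((par ^^ k) u) v" using anc_root assms(2) by simp
  then show "anc (lca u v) v" unfolding lca_def by (rule LeastI)
  show "anc (lca u v) u" by (simp add: lca_def)
  assume "anc w u" "anc w v"
  then obtain m where m: "(par ^^ m) u = w" by (auto simp: anc_def)
  with \<open>anc w v\<close> have "(LEAST k. anc ((par ^^ k) u) v) \<le> m" by (intro Least_le) simp
  then show "anc w (lca u v)" unfolding lca_def using m anc_le_funpow by blast
qed

lemma child_towards:
  assumes "v \<in> V" "anc z v" "z \<noteq> v"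
  shows "\<exists>n\<in>V. anc n v \<and> par n = z \<and> n \<noteq> z \<and> n \<noteq> r"
proof -
  define k where "k = (LEAST k. (par ^^ k) v = z)"
  have k: "(par ^^ k) v = z" unfolding k_def by (rule LeastI_ex) (use assms(2) anc_def in blast)
  then obtain m where m: "k = Suc m" using assms(3) by (cases k) auto
  have "(par ^^ m) v \<noteq> z" using not_less_Least[of m "\<lambda>k. (par ^^ k) v = z"] m k_def by auto
  moreover from this have "(par ^^ m) v \<noteq> r" using k m par_root by auto
  ultimately show ?thesis using k m funpow_par_in[OF assms(1)]
    by (intro bexI[of _ "(par ^^ m) v"]) auto
qed

definition depth :: "'n \<Rightarrow> nat" where
  "depth v = (LEAST k. (par ^^ k) v = r)"

lemma depth_par:
  assumes "v \<in> V" "v \<noteq> r"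
  shows "depth v = Suc (depth (par v))"
proof -
  obtain k where "(par ^^ k) v = r" using reach_root[OF assms(1)] by blast
  then have "depth v = Suc (LEAST k. (par ^^ Suc k) v = r)"
    unfolding depth_def by (rule Least_Suc) (simp add: assms(2))
  then show ?thesis by (simp only: depth_def funpow_Suc_right o_apply)
qed

lemma depth_anc: "anc a v \<Longrightarrow> v \<in> V \<Longrightarrow> a \<noteq> v \<Longrightarrow> depth a < depth v"
proof -
  have "depth ((par ^^ k) v) < depth v \<or> (par ^^ k) v = v" if "v \<in> V" for k
  proof (induction k)
    case (Suc k)
    then show ?case using depth_par[of "(par ^^ k) v"] funpow_par_in[OF that, of k] par_root
      by (cases "(par ^^ k) v = r") auto
  qed auto
  then show "anc a v \<Longrightarrow> v \<in> V \<Longrightarrow> a \<noteq> v \<Longrightarrow> depth a < depth v" unfolding anc_def by blast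
qed

lemma tree_edgeE:
  assumes "{x, y} \<in> tree_edges"
  obtains "x \<in> V" "x \<noteq> r" "y = par x" | "y \<in> V" "y \<noteq> r" "x = par y"
proof -
  obtain n where "n \<in> V" "n \<noteq> r" "{x, y} = {n, par n}" using assms unfolding tree_edges_def by blast
  then show ?thesis using that unfolding doubleton_eq_iff by metis
qed

lemma tree_edgeI: "n \<in> V \<Longrightarrow> n \<noteq> r \<Longrightarrow> {n, par n} \<in> tree_edges"
  unfolding tree_edges_def by auto

lemma extra_not_tree: "e \<in> S \<Longrightarrow> e \<notin> tree_edges"
  using extra[of e] by (auto elim: tree_edgeE)

lemma extra_in: "{a, b} \<in> S \<Longrightarrow> a \<in> V \<and> b \<in> V \<and> a \<noteq> b"
  using extra[of "{a, b}"] by (auto simp: doubleton_eq_iff)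

lemma edges_in: "{x, y} \<in> edges \<Longrightarrow> x \<in> V \<and> y \<in> V"
  unfolding edges_def using extra_in par_in by (auto elim!: tree_edgeE)

lemma simple_edges: "simple_graph V edges"
  unfolding simple_graph_def
proof
  fix e assume "e \<in> edges"
  then show "e \<subseteq> V \<and> card e = 2" unfolding edges_def
  proof
    assume "e \<in> tree_edges"
    then show ?thesis unfolding tree_edges_def using par_neq par_in by (auto simp: card_2_iff doubleton_eq_iff)
  next
    assume "e \<in> S"
    then show ?thesis using extra[of e] by (auto simp: card_2_iff)
  qed
qed

lemma tree_edge_leaving:
  assumes "{x, y} \<in> tree_edges" "anc a x" "\<not> anc a y"
  shows "x = a \<and> y = par a"
  using assms(1)
proof (cases rule: tree_edgeE)
  case 1
  have "x = a" using anc_parD[of a x] assms(2,3) 1(3) by auto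
  then show ?thesis using 1(3) by simp
next
  case 2
  then show ?thesis using assms(2,3) anc_trans[OF _ anc_par] by auto
qed

lemma tree_connected:
  assumes "u \<in> V" "v \<in> V"
  shows "(u, v) \<in> {(x, y). {x, y} \<in> tree_edges}\<^sup>*" (is "_ \<in> ?R\<^sup>*")
proof -
  have up: "(v, (par ^^ k) v) \<in> ?R\<^sup>*" if "v \<in> V" for k v
  proof (induction k)
    case (Suc k)
    then show ?case
      using tree_edgeI[OF funpow_par_in[OF that, of k]] par_root
      by (cases "(par ^^ k) v = r") (auto intro: rtrancl_into_rtrancl)
  qed auto
  have "sym (?R\<^sup>*)" by (rule sym_rtrancl) (auto simp: sym_def insert_commute)
  moreover have "(v, r) \<in> ?R\<^sup>*" if v: "v \<in> V" for v
  proof -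
    obtain k where "(par ^^ k) v = r" using reach_root[OF v] by blast
    then show ?thesis using up[OF v, of k] by simp
  qed
  then have "(u, r) \<in> ?R\<^sup>*" "(v, r) \<in> ?R\<^sup>*" using assms by auto
  ultimately show ?thesis by (meson rtrancl_trans symD)
qed

lemma connected_edges: "connected_graph V edges"
proof -
  have "(u, v) \<in> {(x, y). {x, y} \<in> edges}\<^sup>*" if "u \<in> V" "v \<in> V" for u v
    using tree_connected[OF that] by (rule rtrancl_mono[THEN subsetD, rotated]) (auto simp: edges_def)
  then show ?thesis using simple_edges root_in by (auto simp: connected_graph_def)
qed

lemma fundamental_cycle:
  assumes "e \<in> S"
  shows "\<exists>c. simple_cycle V edges c \<and> cycle_edges c \<inter> S = {e}"
proof -
  obtain a b where e: "e = {a, b}" "a \<in> V" "b \<in> V" "a \<noteq> b" "b \<noteq> par a" "a \<noteq> par b"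
    using extra[OF assms] by blast
  obtain c where c: "distinct c" "c \<noteq> []" "hd c = a" "last c = b"
    "successively (\<lambda>x y. {x, y} \<in> tree_edges) c"
    using rtrancl_distinct_path[OF tree_connected[OF e(2,3)]] by auto
  define n where "n = length c"
  have step: "{c ! i, c ! Suc i} \<in> tree_edges" if "Suc i < n" for i
    using c(5) that by (simp add: successively_conv_nth n_def)
  have ends: "c ! 0 = a" "c ! (n - 1) = b" using c by (auto simp: hd_conv_nth last_conv_nth n_def)
  have "n \<noteq> 0" using c by (simp add: n_def)
  moreover have "n \<noteq> 1" using ends e(4) by auto
  moreover have "n \<noteq> 2"
  proof
    assume n: "n = 2"
    then have "{a, b} \<in> tree_edges" using step[of 0] ends by (simp add: numeral_2_eq_2)
    then show False using extra_not_tree assms e(1) by blast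
  qed
  ultimately have n3: "3 \<le> n" by linarith
  have edge: "{c ! i, c ! (Suc i mod n)} = e \<or> {c ! i, c ! (Suc i mod n)} \<in> tree_edges" if "i < n" for i
  proof (cases "Suc i = n")
    case True
    then have "{c ! i, c ! (Suc i mod n)} = {b, a}" using ends by auto
    then show ?thesis using e(1) by auto
  next
    case False
    then show ?thesis using step[of i] that by auto
  qed
  have "{c ! (n - 1), c ! (Suc (n - 1) mod n)} = e"
    using ends n3 e(1) by auto
  then have mem: "e \<in> cycle_edges c" unfolding cycle_edges_def n_def[symmetric] using n3
    by (metis (mono_tags, lifting) mem_Collect_eq diff_less zero_less_one less_le_trans zero_less_numeral)
  have sub: "cycle_edges c \<subseteq> insert e tree_edges"
    unfolding cycle_edges_def n_def[symmetric] using edge by auto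
  have "set c \<subseteq> V"
  proof
    fix x assume "x \<in> set c"
    then obtain i where "i < n" "x = c ! i" by (auto simp: in_set_conv_nth n_def)
    then have "{x, c ! (Suc i mod n)} = e \<or> {x, c ! (Suc i mod n)} \<in> tree_edges" using edge by blast
    then have "{x, c ! (Suc i mod n)} \<in> edges" using assms unfolding edges_def by auto
    then show "x \<in> V" using edges_in by blast
  qed
  then have "simple_cycle V edges c" using sub n3 c(1) assms
    unfolding simple_cycle_def n_def edges_def by auto
  moreover have "cycle_edges c \<inter> S = {e}" using mem sub assms extra_not_tree by blast
  ultimately show ?thesis by blast
qed

lemma crosses_subI: "anc a x \<Longrightarrow> \<not> anc a y \<Longrightarrow> crosses (sub a) {x, y}"
  unfolding crosses_def by (intro exI[of _ x] exI[of _ y]) auto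

lemma crosses_subD:
  assumes "crosses (sub a) f" "f \<in> edges"
  shows "f \<in> S \<or> f = {a, par a}"
proof -
  obtain x y where xy: "f = {x, y}" "anc a x" "\<not> anc a y" using assms(1) by (auto simp: crosses_def)
  then show ?thesis using tree_edge_leaving[of x y a] assms(2) unfolding edges_def by auto
qed

lemma cactus_one_extra:
  assumes cactus: "cactus V edges" and v: "v \<in> V" and e: "e \<in> S" "e' \<in> S"
    and cross: "crosses (sub v) e" "crosses (sub v) e'"
  shows "e = e'"
proof (rule ccontr)
  assume "e \<noteq> e'"
  have "v \<noteq> r"
  proof
    assume "v = r"
    with cross(1) obtain x y where "e = {x, y}" "\<not> anc r y" by (auto simp: crosses_def)
    then show False using e(1) extra_in anc_root by blast
  qed
  have *: "{v, par v} \<in> cycle_edges c"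
    if c: "simple_cycle V edges c" "cycle_edges c \<inter> S = {e}" "crosses (sub v) e" for c e
  proof -
    obtain f where "f \<in> cycle_edges c" "f \<noteq> e" "crosses (sub v) f"
      using simple_cycle_crosses_other[OF c(1) _ c(3)] c(2) by blast
    moreover from this have "f \<in> S \<or> f = {v, par v}"
      using crosses_subD c(1) unfolding simple_cycle_def by blast
    ultimately show ?thesis using c(2) by blast
  qed
  obtain c c' where c: "simple_cycle V edges c" "cycle_edges c \<inter> S = {e}"
    and c': "simple_cycle V edges c'" "cycle_edges c' \<inter> S = {e'}"
    using fundamental_cycle e by meson
  have "{v, par v} \<subseteq> set c \<inter> set c'"
    using cycle_edge_subset[OF *[OF c cross(1)]] cycle_edge_subset[OF *[OF c' cross(2)]] by (rule Int_greatest)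
  then have "card {v, par v} \<le> card (set c \<inter> set c')" by (intro card_mono) auto
  moreover have "card {v, par v} = 2" using par_neq[OF v \<open>v \<noteq> r\<close>] by (simp add: card_insert_if)
  moreover have "cycle_edges c \<noteq> cycle_edges c'" using c(2) c'(2) \<open>e \<noteq> e'\<close> by auto
  ultimately show False using cactus c(1) c'(1) unfolding cactus_def by fastforce
qed

end

locale cactus_tree = rooted_tree +
  assumes one_extra: "v \<in> V \<Longrightarrow> e \<in> S \<Longrightarrow> e' \<in> S \<Longrightarrow> crosses (sub v) e \<Longrightarrow> crosses (sub v) e' \<Longrightarrow> e = e'"
begin

lemma cycle_eq_fundamental:
  assumes c: "simple_cycle V edges c" and e: "e \<in> cycle_edges c" "e \<in> S"
    and c': "simple_cycle V edges c'" "cycle_edges c' \<inter> S = {e}"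
  shows "cycle_edges c' = cycle_edges c"
proof -
  have ce: "cycle_edges c \<subseteq> edges" using c by (simp add: simple_cycle_def)
  have "cycle_edges c' \<subseteq> cycle_edges c"
  proof
    fix f assume f: "f \<in> cycle_edges c'"
    show "f \<in> cycle_edges c"
    proof (cases "f \<in> S")
      case True
      then have "f \<in> {e}" using f c'(2) by blast
      then show ?thesis using e(1) by simp
    next
      case False
      have "f \<in> edges" using f c'(1) unfolding simple_cycle_def by blast
      then have "f \<in> tree_edges" using False unfolding edges_def by blast
      then obtain m where m: "f = {m, par m}" "m \<in> V" "m \<noteq> r" unfolding tree_edges_def by blast
      have "crosses (sub m) f" unfolding m(1) by (rule crosses_subI) (simp_all add: not_anc_par m)
      then obtain f' where f': "f' \<in> cycle_edges c'" "f' \<noteq> f" "crosses (sub m) f'"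
        using simple_cycle_crosses_other[OF c'(1) f] by blast
      have "f' \<in> edges" using f'(1) c'(1) unfolding simple_cycle_def by blast
      then have "f' \<in> S" using crosses_subD[OF f'(3)] f'(2) m(1) by blast
      then have "f' \<in> {e}" using f'(1) c'(2) by blast
      then have cre: "crosses (sub m) e" using f'(3) by simp
      then obtain g where g: "g \<in> cycle_edges c" "g \<noteq> e" "crosses (sub m) g"
        using simple_cycle_crosses_other[OF c e(1)] by blast
      have "g \<notin> S" using one_extra[OF m(2) _ e(2) g(3) cre] g(2) by blast
      moreover have "g \<in> edges" using g(1) ce by blast
      ultimately show ?thesis using crosses_subD[OF g(3)] m(1) g(1) by blast
    qed
  qed
  then show ?thesis by (rule simple_cycle_minimal[OF c'(1) c])
qed

lemma cycle_extra_edge: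
  assumes c: "simple_cycle V edges c"
  shows "\<exists>e. cycle_edges c \<inter> S = {e}"
proof -
  define n where "n = length c"
  have n: "3 \<le> n" "distinct c" "c \<noteq> []" "set c \<subseteq> V" "cycle_edges c \<subseteq> edges"
    using c by (auto simp: simple_cycle_def n_def)
  define \<phi> where "\<phi> k = c ! (k mod n)" for k
  have edge: "{\<phi> k, \<phi> (Suc k)} \<in> cycle_edges c" for k
    unfolding cycle_edges_nth_mod[OF n(3)] \<phi>_def n_def by (rule rangeI)
  have \<phi>V: "\<phi> k \<in> V" for k
  proof -
    have "\<phi> k \<in> set c" unfolding \<phi>_def n_def using n(3) by (intro nth_mem) simp
    then show ?thesis using n(4) by blast
  qed
  have "\<exists>f\<in>cycle_edges c. f \<in> S"
  proof (rule ccontr)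
    assume no: "\<not> ?thesis"
    obtain x where x: "x \<in> set c" "\<And>y. y \<in> set c \<Longrightarrow> depth y \<le> depth x"
      using Max_in[of "depth ` set c"] Max_ge[of "depth ` set c"] n(3) by fastforce
    obtain k where k: "x = \<phi> (Suc k)"
    proof -
      obtain j where "j \<ge> 1" "x = c ! (j mod length c)" using set_nth_mod[OF n(3), of x 1] x(1) by auto
      then show ?thesis using that[of "j - 1"] by (simp add: \<phi>_def n_def)
    qed
    have mem: "\<phi> i \<in> set c" for i unfolding \<phi>_def n_def using n(3) by (intro nth_mem) simp
    have up: "y = par x" if y: "{x, y} \<in> cycle_edges c" "y \<in> set c" for y
    proof -
      have "{x, y} \<in> tree_edges" using no n(5) y(1) unfolding edges_def by blast
      then show ?thesis
      proof (cases rule: tree_edgeE)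
        case 2
        then show ?thesis using depth_par[of y] x(2)[OF y(2)] by simp
      qed
    qed
    have "{x, \<phi> k} \<in> cycle_edges c" using edge[of k] k by (simp add: insert_commute)
    then have "\<phi> k = par x" using up mem by blast
    moreover have "\<phi> (Suc (Suc k)) = par x" using up[OF _ mem] edge[of "Suc k"] k by simp
    ultimately have "\<phi> (Suc (Suc k)) = \<phi> k" by simp
    then have "Suc (Suc k) mod n = k mod n"
      unfolding \<phi>_def n_def using nth_mod_eq_iff[OF n(2,3)] by blast
    then show False using Suc_Suc_mod_neq[OF n(1)] by blast
  qed
  then obtain e where e: "e \<in> cycle_edges c" "e \<in> S" by blast
  obtain c' where c': "simple_cycle V edges c'" "cycle_edges c' \<inter> S = {e}"
    using fundamental_cycle[OF e(2)] by blast
  then show ?thesis using cycle_eq_fundamental[OF c e] by auto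
qed

lemma cycle_edge_crossing:
  assumes c: "simple_cycle V edges c" "cycle_edges c \<inter> S = {e}" and x: "x \<in> set c"
    and y: "y \<in> set c" "y \<noteq> x" "depth y \<le> depth x"
  shows "x \<in> V \<and> crosses (sub x) e"
proof -
  have V: "x \<in> V" "y \<in> V" using c x y(1) by (auto simp: simple_cycle_def)
  have "\<not> anc x y" using depth_anc[OF _ V(2)] y by force
  then obtain f f' where f: "f \<in> cycle_edges c" "f' \<in> cycle_edges c" "f \<noteq> f'"
    "crosses (sub x) f" "crosses (sub x) f'"
    using simple_cycle_crosses_twice[OF c(1), of x "sub x" y] x y(1) by auto
  have "f \<in> edges" "f' \<in> edges" using f(1,2) c(1) unfolding simple_cycle_def by blast+
  then have "f \<in> S \<or> f' \<in> S" using crosses_subD f(3-5) by metis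
  then have "f \<in> {e} \<or> f' \<in> {e}" using f(1,2) c(2) by blast
  then show ?thesis using V f(4,5) by auto
qed

theorem cactus_edges: "cactus V edges"
  unfolding cactus_def
proof (intro conjI allI impI connected_edges, elim conjE)
  fix c c' assume c: "simple_cycle V edges c" "simple_cycle V edges c'" "cycle_edges c \<noteq> cycle_edges c'"
  obtain e e' where e: "cycle_edges c \<inter> S = {e}" "cycle_edges c' \<inter> S = {e'}"
    using cycle_extra_edge c by meson
  have eS: "e \<in> S" "e' \<in> S" using e by auto
  show "card (set c \<inter> set c') \<le> 1"
  proof (rule ccontr)
    assume "\<not> ?thesis"
    then obtain x y where "x \<in> set c \<inter> set c'" "y \<in> set c \<inter> set c'" "y \<noteq> x"
      using card_le_Suc0_iff_eq[of "set c \<inter> set c'"] by auto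
    then obtain x y where xy: "x \<in> set c \<inter> set c'" "y \<in> set c \<inter> set c'" "y \<noteq> x" "depth y \<le> depth x"
      by (cases "depth y \<le> depth x") (simp, metis linear)
    have "crosses (sub x) e" "crosses (sub x) e'" "x \<in> V"
      using cycle_edge_crossing[OF c(1) e(1) _ _ xy(3,4)] cycle_edge_crossing[OF c(2) e(2) _ _ xy(3,4)] xy(1,2)
      by auto
    then have ee: "e = e'" using one_extra eS by blast
    obtain d where d: "simple_cycle V edges d" "cycle_edges d \<inter> S = {e}"
      using fundamental_cycle[OF eS(1)] by blast
    have "e \<in> cycle_edges c" "e \<in> cycle_edges c'" using e ee by auto
    then show False
      using c(3) cycle_eq_fundamental[OF c(1) _ eS(1) d] cycle_eq_fundamental[OF c(2) _ eS(1) d] by simp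
  qed
qed

end

section \<open>Coarse geodesics in a tree with extra edges\<close>

text \<open>The last assumption replaces geodesics: two vertices are joined by a path in the graph all of
  whose vertices lie coarsely between them. It is satisfied by the path metric of the graph itself
  and by every geodesic metric that is quasi-isometric to it.\<close>

locale coarse_cactus = cactus_tree +
  fixes \<rho> :: "'a \<Rightarrow> 'a \<Rightarrow> real" and K c :: real
  assumes dist_self: "x \<in> V \<Longrightarrow> \<rho> x x = 0"
    and dist_sym: "x \<in> V \<Longrightarrow> y \<in> V \<Longrightarrow> \<rho> x y = \<rho> y x"
    and dist_tri: "x \<in> V \<Longrightarrow> y \<in> V \<Longrightarrow> z \<in> V \<Longrightarrow> \<rho> x z \<le> \<rho> x y + \<rho> y z"
    and K_nonneg: "0 \<le> K" and c_nonneg: "0 \<le> c"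
    and edge_le: "{x, y} \<in> edges \<Longrightarrow> \<rho> x y \<le> c"
    and between: "u \<in> V \<Longrightarrow> v \<in> V \<Longrightarrow>
      (u, v) \<in> (induced edges {w \<in> V. \<rho> u w + \<rho> w v \<le> \<rho> u v + K})\<^sup>*"
begin

definition near :: "'a \<Rightarrow> 'a \<Rightarrow> 'a set" where
  "near u v = {w \<in> V. \<rho> u w + \<rho> w v \<le> \<rho> u v + K}"

lemma near_ends: "u \<in> V \<Longrightarrow> v \<in> V \<Longrightarrow> u \<in> near u v" "u \<in> V \<Longrightarrow> v \<in> V \<Longrightarrow> v \<in> near u v"
  using K_nonneg by (auto simp: near_def dist_self)

lemma rtrancl_crossing:
  assumes "(u, v) \<in> R\<^sup>*" "u \<in> A" "v \<notin> A"
  shows "\<exists>x y. (x, y) \<in> R \<and> x \<in> A \<and> y \<notin> A"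
  using assms(1,3)
proof (induction rule: rtrancl_induct)
  case (step x y)
  then show ?case by (cases "x \<in> A") auto
qed (use assms(2) in auto)

lemma near_crossing:
  assumes "u \<in> V" "v \<in> V" "u \<in> A" "v \<notin> A"
  shows "\<exists>x y. {x, y} \<in> edges \<and> x \<in> A \<and> y \<notin> A \<and> x \<in> near u v \<and> y \<in> near u v"
proof -
  have "(u, v) \<in> (induced edges (near u v))\<^sup>*" using between[OF assms(1,2)] by (simp add: near_def)
  from rtrancl_crossing[OF this assms(3,4)] show ?thesis by (auto simp: induced_def)
qed

lemma near_crossing':
  assumes "u \<in> V" "v \<in> V" "u \<notin> A" "v \<in> A"
  shows "\<exists>x y. {x, y} \<in> edges \<and> x \<in> A \<and> y \<notin> A \<and> x \<in> near u v \<and> y \<in> near u v"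
proof -
  obtain x y where "{x, y} \<in> edges" "x \<notin> A" "y \<in> A" "x \<in> near u v" "y \<in> near u v"
    using near_crossing[of u v "- A"] assms by auto
  then show ?thesis by (intro exI[of _ y] exI[of _ x]) (auto simp: insert_commute)
qed

text \<open>The set \<open>A\<close> below is \<open>sub a\<close> without the part hanging from the child of \<open>q\<close> towards \<open>\<alpha>\<close>. As the
  extra edge at \<open>\<alpha>\<close> is the only one leaving \<open>sub a\<close> or that part, it can be left only
  through \<open>a\<close> or \<open>q\<close>.\<close>

lemma near_separation:
  assumes a: "a \<in> V" and e: "{\<alpha>, \<beta>} \<in> S" "anc a \<alpha>" "\<not> anc a \<beta>" and q: "anc a q" "anc q \<alpha>"
    and A: "A = {x. anc a x \<and> (\<forall>w. anc w x \<and> anc w \<alpha> \<longrightarrow> anc w q)}"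
    and uv: "u \<in> V" "v \<in> V" "u \<in> A \<longleftrightarrow> v \<notin> A"
  shows "a \<in> near u v \<and> par a \<in> near u v \<or> q \<in> near u v"
proof -
  obtain x y where xy: "{x, y} \<in> edges" "x \<in> A" "y \<notin> A" "x \<in> near u v" "y \<in> near u v"
    using near_crossing[OF uv(1,2), of A] near_crossing'[OF uv(1,2), of A] uv(3) by blast
  have V: "x \<in> V" "y \<in> V" "\<alpha> \<in> V" "\<beta> \<in> V" using edges_in[OF xy(1)] extra_in[OF e(1)] by auto
  have only: "{x, y} = {\<alpha>, \<beta>}" if w: "w \<in> V" "anc w \<alpha>" "\<not> anc w \<beta>" "crosses (sub w) {x, y}" "{x, y} \<in> S" for w
    using one_extra[OF w(1,5) e(1) w(4)] crosses_subI[OF w(2,3)] by blast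
  have ax: "anc a x" and below: "\<And>w. anc w x \<Longrightarrow> anc w \<alpha> \<Longrightarrow> anc w q" using xy(2) A by auto
  show ?thesis
  proof (cases "anc a y")
    case False
    have "crosses (sub a) {x, y}" by (rule crosses_subI[OF ax False])
    show ?thesis
    proof (cases "{x, y} \<in> S")
      case True
      then have "{x, y} = {\<alpha>, \<beta>}" using only[OF a e(2,3) \<open>crosses (sub a) {x, y}\<close>] by blast
      then have "x = \<alpha>" using ax e(3) by (auto simp: doubleton_eq_iff)
      then have "anc \<alpha> q" using below by simp
      then have "q = \<alpha>" using anc_antisym[OF V(3) q(2)] by blast
      then show ?thesis using xy(4) \<open>x = \<alpha>\<close> by simp
    next
      case False
      then have "{x, y} \<in> tree_edges" using xy(1) by (simp add: edges_def)
      then show ?thesis using tree_edge_leaving[OF _ ax \<open>\<not> anc a y\<close>] xy(4,5) by auto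
    qed
  next
    case True
    then obtain w where w: "anc w y" "anc w \<alpha>" "\<not> anc w q" using xy(3) A by auto
    have wx: "\<not> anc w x" using below w(2,3) by blast
    have qw: "anc q w" using anc_linear[OF w(2) q(2)] w(3) by blast
    have w\<beta>: "\<not> anc w \<beta>" using e(3) anc_trans[OF anc_trans[OF q(1) qw]] by blast
    have wV: "w \<in> V" using anc_in[OF w(2) V(3)] .
    show ?thesis
    proof (cases "{x, y} \<in> S")
      case True
      have "crosses (sub w) {x, y}" using crosses_subI[OF w(1) wx] by (simp add: insert_commute)
      then have "{x, y} = {\<alpha>, \<beta>}" using only[OF wV w(2) w\<beta>] True by blast
      then have "x = \<beta>" using wx w(2) by (auto simp: doubleton_eq_iff)
      then show ?thesis using ax e(3) by simp
    next
      case False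
      then have "{y, x} \<in> tree_edges" using xy(1) by (simp add: edges_def insert_commute)
      then have yw: "y = w" "x = par w" using tree_edge_leaving[OF _ w(1) wx] by auto
      have "anc x q" using below[of x] yw anc_trans[OF anc_par w(2)] by simp
      moreover have "anc q x" using anc_parD[OF qw] w(3) yw by (cases "q = w") auto
      ultimately have "q = x" using anc_antisym[OF V(1)] by blast
      then show ?thesis using xy(4) by simp
    qed
  qed
qed

lemma nearD: "w \<in> near u v \<Longrightarrow> w \<in> V \<and> \<rho> u w + \<rho> w v \<le> \<rho> u v + K"
  by (simp add: near_def)

text \<open>Suppose the coarse geodesic from \<open>r\<close> to \<open>v\<close> avoids \<open>a\<close>. It then enters \<open>sub a\<close> by an
  extra edge \<open>{\<alpha>, \<beta>}\<close> and passes through \<open>q = lca \<alpha> v\<close>. Among the vertices from \<open>a\<close> down to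
  \<open>q\<close>, those reached from \<open>r\<close> through \<open>a\<close> are followed by one reached through \<open>q\<close>, which
  is close to \<open>q\<close> because heights increase along the tree.\<close>

lemma tree_geodesic:
  assumes mono: "\<And>v. v \<in> V \<Longrightarrow> H (par v) \<le> (H v :: real)"
    and close: "\<And>v. v \<in> V \<Longrightarrow> \<bar>H v - \<rho> r v\<bar> \<le> B"
    and v: "v \<in> V" and av: "anc a v"
  shows "\<rho> r a + \<rho> a v \<le> \<rho> r v + (4 * B + 3 * K + c)"
proof -
  have B: "0 \<le> B" using close[OF root_in] by linarith
  have aV: "a \<in> V" using anc_in[OF av v] .
  have mono': "H b \<le> H w" if "anc b w" "w \<in> V" for b w
  proof -
    obtain k where "(par ^^ k) w = b" using \<open>anc b w\<close> anc_def by blast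
    moreover have "H ((par ^^ k) w) \<le> H w"
    proof (induction k)
      case (Suc k)
      then show ?case using mono[OF funpow_par_in[OF \<open>w \<in> V\<close>, of k]] by simp
    qed auto
    ultimately show ?thesis by simp
  qed
  show ?thesis
  proof (cases "a \<in> near r v")
    case True
    then show ?thesis using nearD[OF True] B K_nonneg c_nonneg by linarith
  next
    case False
    have "\<not> anc a r" using False anc_of_root[of a] near_ends(1)[OF root_in v] by auto
    then obtain x y where xy: "{x, y} \<in> edges" "anc a x" "\<not> anc a y" "x \<in> near r v" "y \<in> near r v"
      using near_crossing'[OF root_in v, of "sub a"] av by auto
    have xyS: "{x, y} \<in> S"
      using xy(1) tree_edge_leaving[OF _ xy(2,3)] xy(4) False unfolding edges_def by auto
    have xV: "x \<in> V" using extra_in[OF xyS] by simp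
    define q where "q = lca x v"
    have q: "anc q x" "anc q v" and q_max: "\<And>w. anc w x \<Longrightarrow> anc w v \<Longrightarrow> anc w q"
      unfolding q_def using lca[OF xV v] by auto
    have aq: "anc a q" using q_max xy(2) av .
    have qV: "q \<in> V" using anc_in[OF q(2) v] .
    have sep: "a \<in> near r w \<or> q \<in> near r w" if w: "w \<in> V" "anc a w" "\<And>b. anc b w \<Longrightarrow> anc b x \<Longrightarrow> anc b q" for w
      using near_separation[OF aV xyS xy(2,3) aq q(1) HOL.refl root_in w(1)] w \<open>\<not> anc a r\<close> by blast
    have qv: "q \<in> near r v" using sep[OF v av] q_max False by blast
    have chain: "a \<in> near r ((par ^^ k) q) \<or> q \<in> near r ((par ^^ k) q)" if "anc a ((par ^^ k) q)" for k
      by (rule sep[OF funpow_par_in[OF qV] that]) (rule anc_trans[OF _ anc_funpow])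
    obtain k0 where k0: "(par ^^ k0) q = a" using aq anc_def by blast
    define k where "k = (LEAST k. a \<in> near r ((par ^^ k) q))"
    have ex: "a \<in> near r ((par ^^ k0) q)" using k0 near_ends(2)[OF root_in aV] by simp
    have k: "a \<in> near r ((par ^^ k) q)" unfolding k_def using ex by (rule LeastI)
    have "k \<le> k0" unfolding k_def using ex by (rule Least_le)
    have "\<rho> r a + \<rho> a q \<le> \<rho> r q + (4 * B + 2 * K + c)"
    proof (cases k)
      case 0
      then show ?thesis using nearD[OF k] B K_nonneg c_nonneg by simp
    next
      case (Suc m)
      define w' w where "w' = (par ^^ m) q" and "w = (par ^^ k) q"
      have wV: "w' \<in> V" "w \<in> V" unfolding w'_def w_def using funpow_par_in[OF qV] by auto
      have w: "w = par w'" unfolding w_def w'_def Suc by simp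
      have "anc a w'" unfolding w'_def using anc_le_funpow[of m k0 q] k0 \<open>k \<le> k0\<close> Suc by simp
      moreover have "a \<notin> near r w'"
        using not_less_Least[of m "\<lambda>k. a \<in> near r ((par ^^ k) q)"] Suc unfolding k_def w'_def by simp
      ultimately have "q \<in> near r w'" using chain[of m] unfolding w'_def by blast
      then have 1: "\<rho> r q + \<rho> q w' \<le> \<rho> r w' + K" using nearD by blast
      have 2: "\<rho> r a + \<rho> a w \<le> \<rho> r w + K" using k nearD unfolding w_def by blast
      have 3: "H w' \<le> H q" "H w \<le> H q" by (intro mono' qV, simp add: w'_def w_def)+
      have 4: "\<rho> w w' \<le> c"
      proof (cases "w' = r")
        case True
        then show ?thesis using w par_root dist_self[OF root_in] c_nonneg by simp
      next
        case False
        then have "{w', w} \<in> edges" using tree_edgeI[OF wV(1)] w by (simp add: edges_def)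
        then show ?thesis using edge_le dist_sym[OF wV] by fastforce
      qed
      have "\<rho> a q \<le> \<rho> a w + \<rho> w q" "\<rho> w q \<le> \<rho> w w' + \<rho> w' q" "\<rho> w' q = \<rho> q w'"
        by (intro dist_tri dist_sym aV wV qV)+
      then show ?thesis using 1 2 3 4 close[OF wV(1)] close[OF wV(2)] close[OF qV] by argo
    qed
    moreover have "\<rho> r q + \<rho> q v \<le> \<rho> r v + K" using nearD[OF qv] by blast
    moreover have "\<rho> a v \<le> \<rho> a q + \<rho> q v" using dist_tri aV qV v by blast
    ultimately show ?thesis by linarith
  qed
qed

lemma near_lca_or_exit:
  assumes n: "n \<in> V" and u: "u \<in> V" "anc n u" and e: "{a, b} \<in> S" "anc n a" "\<not> anc n b"
  shows "par n \<in> near u a \<or> lca u a \<in> near u a"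
proof (cases "lca u a = a")
  case True
  then show ?thesis using near_ends(2) u(1) extra_in[OF e(1)] by auto
next
  case False
  define i where "i = lca u a"
  have aV: "a \<in> V" using extra_in[OF e(1)] by simp
  have i: "anc i u" "anc i a" "\<And>w. anc w u \<Longrightarrow> anc w a \<Longrightarrow> anc w i"
    unfolding i_def using lca[OF u(1) aV] by auto
  have "\<not> anc a i" using anc_antisym[OF aV i(2)] False i_def by auto
  define A where "A = {x. anc n x \<and> (\<forall>w. anc w x \<and> anc w a \<longrightarrow> anc w i)}"
  have "u \<in> A" using u(2) i(3) by (simp add: A_def)
  moreover have "a \<notin> A" using \<open>\<not> anc a i\<close> anc_refl[of a] unfolding A_def by blast
  ultimately show ?thesis
    using near_separation[OF n e i(3)[OF u(2) e(2)] i(2) A_def u(1) aV] unfolding i_def[symmetric] by blast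
qed

lemma crossing_below_lca:
  assumes uv: "u \<in> V" "v \<in> V" and z: "z \<notin> near u v"
    and n: "n \<in> V" "par n = z" "n \<noteq> z" "anc n u"
    and m: "m \<in> V" "par m = z" "m \<noteq> z" "anc m v" "\<not> anc n v" "\<not> anc m u"
  shows "\<exists>a b. {a, b} \<in> S \<and> anc n a \<and> \<not> anc n b \<and> anc m b \<and> \<not> anc m a \<and> a \<in> near u v \<and> b \<in> near u v"
proof -
  obtain a b where ab: "{a, b} \<in> edges" "anc n a" "\<not> anc n b" "a \<in> near u v" "b \<in> near u v"
    using near_crossing[OF uv, of "sub n"] n(4) m(5) by auto
  have S: "{a, b} \<in> S"
    using ab(1) tree_edge_leaving[OF _ ab(2,3)] ab(5) z n(2) unfolding edges_def by auto
  have V: "a \<in> V" "b \<in> V" using extra_in[OF S] by auto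
  have zV: "z \<in> V" using par_in[OF n(1)] n(2) by simp
  have leave: "{x, y} = {a, b}"
    if l: "l \<in> V" "{x, y} \<in> edges" "anc l x" "\<not> anc l y" "x = l \<and> y = par l \<longrightarrow> z \<in> {l, par l}"
      "crosses (sub l) {a, b}" "x \<in> near u v" "y \<in> near u v" for l x y
  proof -
    have "\<not> (x = l \<and> y = par l)" using l(5,7,8) z by auto
    then have "{x, y} \<notin> tree_edges" using tree_edge_leaving[OF _ l(3,4)] by blast
    then have "{x, y} \<in> S" using l(2) unfolding edges_def by blast
    from one_extra[OF l(1) this S crosses_subI[OF l(3,4)] l(6)] show ?thesis .
  qed
  have zn: "anc z n" "anc z m" using anc_par[of n] anc_par[of m] unfolding n(2) m(2) by auto
  have za: "anc z a" by (rule anc_trans[OF zn(1) ab(2)])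
  have zz: "anc z u" "anc z v" using anc_trans[OF zn(1) n(4)] anc_trans[OF zn(2) m(4)] by auto
  have cn: "crosses (sub n) {a, b}" by (rule crosses_subI[OF ab(2,3)])
  have "anc m b"
  proof (rule ccontr)
    assume mb: "\<not> anc m b"
    show False
    proof (cases "anc z b")
      case False
      have cz: "crosses (sub z) {a, b}" by (rule crosses_subI[OF za False])
      obtain x y where xy: "{x, y} \<in> edges" "x \<in> {x. anc z x \<and> \<not> anc n x}" "y \<notin> {x. anc z x \<and> \<not> anc n x}"
        "x \<in> near u v" "y \<in> near u v"
        using near_crossing'[OF uv, of "{x. anc z x \<and> \<not> anc n x}"] n(4) m(5) zz by auto
      show False
      proof (cases "anc z y")
        case True
        then have "anc n y" using xy(3) by blast
        then have "{y, x} = {a, b}"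
          using leave[of n y x] xy n(1,2) cn by (auto simp: insert_commute)
        then show False using xy(2) False ab(2) by (auto simp: doubleton_eq_iff)
      next
        case False
        then have "{x, y} = {a, b}" using leave[of z x y] xy zV cz by auto
        then show False using xy(2) ab(2) \<open>\<not> anc z b\<close> by (auto simp: doubleton_eq_iff)
      qed
    next
      case True
      have "z \<noteq> b" using z ab(5) by blast
      then obtain l where l: "l \<in> V" "anc l b" "par l = z" "l \<noteq> z" using child_towards[OF V(2) True] by blast
      have la: "\<not> anc l a" using siblings[of l n a] l n(1,2,3) ab(2,3) by auto
      have lv: "\<not> anc l v" using siblings[of l m v] l m(1-4) mb by auto
      have cl: "crosses (sub l) {a, b}" using crosses_subI[OF l(2) la] by (simp add: insert_commute)
      obtain x y where xy: "{x, y} \<in> edges" "x \<in> sub n \<union> sub l" "y \<notin> sub n \<union> sub l"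
        "x \<in> near u v" "y \<in> near u v"
        using near_crossing[OF uv, of "sub n \<union> sub l"] n(4) m(5) lv by auto
      have "{x, y} = {a, b}"
        using xy leave[of n x y] leave[of l x y] n(1,2) l(1,3) cn cl by auto
      then show False using xy(3) ab(2) l(2) by (auto simp: doubleton_eq_iff)
    qed
  qed
  moreover have "\<not> anc m a" using siblings[of m n a] m(1-3) n(1-3) ab(2) m(5) m(4) by auto
  ultimately show ?thesis using S ab by blast
qed

theorem near_dichotomy:
  assumes u: "u \<in> V" and v: "v \<in> V"
  shows "(\<exists>z. anc z u \<and> anc z v \<and> \<rho> u z + \<rho> z v \<le> \<rho> u v + 2 * K) \<or>
    (\<exists>a b i j. {a, b} \<in> S \<and> anc i u \<and> anc i a \<and> anc j v \<and> anc j b \<and>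
      \<rho> u i + \<rho> i a + \<rho> b j + \<rho> j v \<le> \<rho> u v + 3 * K + c)" (is "?tree \<or> ?extra")
proof -
  define z where "z = lca u v"
  have z: "anc z u" "anc z v" "\<And>w. anc w u \<Longrightarrow> anc w v \<Longrightarrow> anc w z"
    unfolding z_def using lca[OF u v] by auto
  have zV: "z \<in> V" using anc_in[OF z(1) u] .
  show ?thesis
  proof (cases "z \<in> near u v")
    case True
    then have "\<rho> u z + \<rho> z v \<le> \<rho> u v + 2 * K" using nearD[OF True] K_nonneg by linarith
    then show ?thesis using z(1,2) by blast
  next
    case False
    then have "z \<noteq> u" "z \<noteq> v" using near_ends[OF u v] by auto
    then obtain n m where n: "n \<in> V" "anc n u" "par n = z" "n \<noteq> z"
      and m: "m \<in> V" "anc m v" "par m = z" "m \<noteq> z"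
      using child_towards[OF u z(1)] child_towards[OF v z(2)] by blast
    have nm: "\<not> anc n v" "\<not> anc m u"
      using z(3)[OF n(2)] z(3)[OF _ m(2)] n m not_anc_par par_root by metis+
    obtain a b where ab: "{a, b} \<in> S" "anc n a" "\<not> anc n b" "anc m b" "\<not> anc m a"
      "a \<in> near u v" "b \<in> near u v"
      using crossing_below_lca[OF u v False n(1,3,4,2) m(1,3,4,2) nm] by blast
    have V: "a \<in> V" "b \<in> V" using extra_in[OF ab(1)] by auto
    have abc: "\<rho> a b \<le> c" using edge_le ab(1) by (simp add: edges_def)
    have na: "\<rho> u a + \<rho> a v \<le> \<rho> u v + K" and nb: "\<rho> u b + \<rho> b v \<le> \<rho> u v + K"
      using nearD[OF ab(6)] nearD[OF ab(7)] by auto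
    have ba: "{b, a} \<in> S" using ab(1) by (simp add: insert_commute)
    consider "z \<in> near u a" | "z \<in> near v b" | "lca u a \<in> near u a" "lca v b \<in> near v b"
      using near_lca_or_exit[OF n(1) u n(2) ab(1-3)] near_lca_or_exit[OF m(1) v m(2) ba ab(4,5)]
      unfolding n(3) m(3) by blast
    then show ?thesis
    proof cases
      case 1
      have "\<rho> z v \<le> \<rho> z a + \<rho> a v" using dist_tri zV V v by blast
      then have "\<rho> u z + \<rho> z v \<le> \<rho> u v + 2 * K" using nearD[OF 1] na by linarith
      then show ?thesis using z(1,2) by blast
    next
      case 2
      have "\<rho> u z \<le> \<rho> u b + \<rho> b z" using dist_tri zV V u by blast
      moreover have "\<rho> b z = \<rho> z b" "\<rho> v z = \<rho> z v" "\<rho> v b = \<rho> b v" using dist_sym zV V v by auto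
      ultimately have "\<rho> u z + \<rho> z v \<le> \<rho> u v + 2 * K" using nearD[OF 2] nb by linarith
      then show ?thesis using z(1,2) by blast
    next
      case 3
      define i j where "i = lca u a" and "j = lca v b"
      have ij: "anc i u" "anc i a" "anc j v" "anc j b"
        unfolding i_def j_def using lca[OF u V(1)] lca[OF v V(2)] by auto
      have jV: "j \<in> V" using anc_in[OF ij(3) v] .
      have "\<rho> b v \<le> \<rho> b a + \<rho> a v" using dist_tri V v by blast
      moreover have "\<rho> b a = \<rho> a b" "\<rho> v j = \<rho> j v" "\<rho> j b = \<rho> b j" "\<rho> v b = \<rho> b v"
        using dist_sym V v jV by auto
      ultimately have "\<rho> u i + \<rho> i a + \<rho> b j + \<rho> j v \<le> \<rho> u v + 3 * K + c"
        using nearD[OF 3(1)] nearD[OF 3(2)] na abc unfolding i_def[symmetric] j_def[symmetric] by linarith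
      then show ?thesis using ab(1) ij by blast
    qed
  qed
qed

end

section \<open>Stretching a cactus along a height function\<close>

text \<open>Every tree edge \<open>{n, par n}\<close> is given the length \<open>H n - H (par n)\<close>: it is contracted if this
  is 0 and subdivided otherwise. The new vertex \<open>nd n t\<close> lies at height \<open>t\<close>, above
  \<open>H (par n)\<close> and at most \<open>H n\<close>. An extra edge \<open>{a, b}\<close> is attached at
  equal heights, so that it creates no shortcut to the root.\<close>

locale cactus_height = cactus_tree V r par S
  for V :: "'n set" and r :: 'n and par :: "'n \<Rightarrow> 'n" and S :: "'n set set" +
  fixes H :: "'n \<Rightarrow> nat" and nd :: "'n \<Rightarrow> nat \<Rightarrow> 'q"
  assumes H_root: "H r = 0" and H_par: "v \<in> V \<Longrightarrow> H (par v) \<le> H v"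
    and nd_inject: "nd m s = nd n t \<longleftrightarrow> m = n \<and> s = t"
begin

definition isnode :: "'n \<Rightarrow> nat \<Rightarrow> bool" where
  "isnode n t \<longleftrightarrow> n \<in> V \<and> t \<le> H n \<and> (n = r \<or> H (par n) < t)"

definition top :: "'n \<Rightarrow> nat \<Rightarrow> 'n" where
  "top v t = (SOME n. anc n v \<and> isnode n t)"

definition Q :: "'q set" where
  "Q = {nd n t | n t. isnode n t}"

definition qpar :: "'q \<Rightarrow> 'q" where
  "qpar x = (case inv (\<lambda>(n, t). nd n t) x of (n, t) \<Rightarrow> nd (top n (t - 1)) (t - 1))"

definition qextra :: "'q set set" where
  "qextra = {{nd (top a s) s, nd (top b s) s} | a b s.
     {a, b} \<in> S \<and> s = min (H a) (H b) \<and> top a s \<noteq> top b s}"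

lemma inv_nd: "inv (\<lambda>(n, t). nd n t) (nd n t) = (n, t)"
proof -
  have "inj (\<lambda>(n, t). nd n t)" by (auto simp: inj_def nd_inject)
  from inv_f_f[OF this, of "(n, t)"] show ?thesis by simp
qed

lemma qpar_nd: "qpar (nd n t) = nd (top n (t - 1)) (t - 1)"
  by (simp add: qpar_def inv_nd)

lemma H_anc: "anc a v \<Longrightarrow> v \<in> V \<Longrightarrow> H a \<le> H v"
proof -
  assume v: "v \<in> V" and "anc a v"
  then obtain k where "(par ^^ k) v = a" using anc_def by blast
  moreover have "H ((par ^^ k) v) \<le> H v"
  proof (induction k)
    case (Suc k)
    then show ?case using H_par[OF funpow_par_in[OF v, of k]] by simp
  qed auto
  ultimately show ?thesis by simp
qed

lemma node_unique:
  assumes "v \<in> V" "anc n v" "anc m v" "isnode n t" "isnode m t"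
  shows "n = m"
proof -
  have *: "n = m" if nm: "anc n m" "isnode n t" "isnode m t" for n m
  proof (rule ccontr)
    assume "n \<noteq> m"
    then have "anc n (par m)" using anc_parD nm(1) by blast
    moreover have "m \<noteq> r" using nm(1) anc_of_root \<open>n \<noteq> m\<close> by blast
    ultimately show False using H_anc[of n "par m"] nm(2,3) par_in by (auto simp: isnode_def)
  qed
  show ?thesis using anc_linear[OF assms(2,3)] *[of n m] *[of m n] assms(4,5) by auto
qed

lemma node_exists:
  assumes "v \<in> V" "t \<le> H v"
  shows "\<exists>n. anc n v \<and> isnode n t"
  using assms
proof (induction "depth v" arbitrary: v rule: less_induct)
  case less
  show ?case
  proof (cases "v = r \<or> H (par v) < t")
    case True
    then show ?thesis using less.prems by (intro exI[of _ v]) (auto simp: isnode_def)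
  next
    case False
    then obtain n where "anc n (par v)" "isnode n t"
      using less.hyps[of "par v"] depth_par[OF less.prems(1)] par_in[OF less.prems(1)] by auto
    then show ?thesis using anc_trans[OF _ anc_par] by blast
  qed
qed

lemma top:
  assumes "v \<in> V" "t \<le> H v"
  shows "anc (top v t) v" "isnode (top v t) t"
  using someI_ex[OF node_exists[OF assms]] unfolding top_def by auto

lemma isnode_in: "isnode n t \<Longrightarrow> n \<in> V \<and> t \<le> H n"
  by (simp add: isnode_def)

lemma top_eqI: "v \<in> V \<Longrightarrow> anc n v \<Longrightarrow> isnode n t \<Longrightarrow> top v t = n"
proof -
  assume v: "v \<in> V" and n: "anc n v" "isnode n t"
  have "t \<le> H v" using H_anc[OF n(1) v] isnode_in[OF n(2)] by simp
  then show ?thesis using node_unique[OF v _ n(1) _ n(2)] top v by blast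
qed

lemma top_node: "isnode n t \<Longrightarrow> top n t = n"
  using top_eqI isnode_in by simp

lemma top_anc:
  assumes "v \<in> V" "anc i v" "t \<le> H i"
  shows "top i t = top v t"
proof -
  have i: "i \<in> V" using anc_in[OF assms(2,1)] .
  show ?thesis using top_eqI[OF assms(1) anc_trans[OF top(1)[OF i assms(3)] assms(2)] top(2)[OF i assms(3)]] by simp
qed

lemma top_top:
  assumes "v \<in> V" "s \<le> t" "t \<le> H v"
  shows "top (top v t) s = top v s"
  using top_anc[OF assms(1) top(1)[OF assms(1,3)]] isnode_in[OF top(2)[OF assms(1,3)]] assms(2) by simp

lemma isnode_root: "isnode r 0"
  by (simp add: isnode_def root_in)

lemma top_0: "v \<in> V \<Longrightarrow> top v 0 = r"
  by (rule top_eqI[OF _ anc_root isnode_root])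

lemma funpow_qpar:
  assumes "isnode n t"
  shows "(qpar ^^ k) (nd n t) = nd (top n (t - k)) (t - k)"
proof (induction k)
  case 0
  then show ?case using top_node[OF assms] by simp
next
  case (Suc k)
  have n: "n \<in> V" "t \<le> H n" using isnode_in[OF assms] by auto
  have "(qpar ^^ Suc k) (nd n t) = nd (top (top n (t - k)) (t - k - 1)) (t - k - 1)"
    using Suc by (simp add: qpar_nd)
  then show ?case using top_top[OF n(1), of "t - k - 1" "t - k"] n(2) by simp
qed

lemma nd_in_Q: "isnode n t \<Longrightarrow> nd n t \<in> Q"
  unfolding Q_def by blast

lemma qextraE:
  assumes "{x, y} \<in> qextra"
  obtains a b s where "{a, b} \<in> S" "s = min (H a) (H b)" "x = nd (top a s) s" "y = nd (top b s) s"
    "top a s \<noteq> top b s"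
proof -
  obtain a b s where ab: "{a, b} \<in> S" "s = min (H a) (H b)" "top a s \<noteq> top b s"
    "{x, y} = {nd (top a s) s, nd (top b s) s}"
    using assms unfolding qextra_def by blast
  from ab(4) consider "x = nd (top a s) s" "y = nd (top b s) s" | "x = nd (top b s) s" "y = nd (top a s) s"
    by (auto simp: doubleton_eq_iff)
  then show ?thesis
  proof cases
    case 1
    then show ?thesis using that ab by blast
  next
    case 2
    then show ?thesis using that[of b a s] ab by (simp add: insert_commute min.commute)
  qed
qed

lemma qextra_nodes:
  assumes "{a, b} \<in> S" "s = min (H a) (H b)"
  shows "isnode (top a s) s" "isnode (top b s) s" "a \<in> V" "b \<in> V" "s \<le> H a" "s \<le> H b"
  using top(2)[of a s] top(2)[of b s] extra_in[OF assms(1)] assms(2) by auto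

sublocale q: rooted_tree Q "nd r 0" qpar qextra
proof
  show "nd r 0 \<in> Q" by (rule nd_in_Q[OF isnode_root])
  show "qpar (nd r 0) = nd r 0" by (simp add: qpar_nd top_0 root_in)
  fix x assume "x \<in> Q"
  then obtain n t where x: "x = nd n t" "isnode n t" unfolding Q_def by blast
  have n: "n \<in> V" "t \<le> H n" using isnode_in[OF x(2)] by auto
  show "qpar x \<in> Q" using top(2)[of n "t - 1"] n by (simp add: x qpar_nd nd_in_Q)
  show "\<exists>k. (qpar ^^ k) x = nd r 0"
    using funpow_qpar[OF x(2), of t] top_0[OF n(1)] x(1) by (intro exI[of _ t]) simp
next
  fix e assume e: "e \<in> qextra"
  then obtain x y where xy: "e = {x, y}" unfolding qextra_def by blast
  with e obtain a b s where ab: "{a, b} \<in> S" "s = min (H a) (H b)"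
    "x = nd (top a s) s" "y = nd (top b s) s" "top a s \<noteq> top b s" by (auto elim: qextraE)
  note nodes = qextra_nodes[OF ab(1,2)]
  have "s \<noteq> 0" using ab(5) top_0[OF nodes(3)] top_0[OF nodes(4)] by (intro notI) simp
  then show "\<exists>x y. e = {x, y} \<and> x \<in> Q \<and> y \<in> Q \<and> x \<noteq> y \<and> y \<noteq> qpar x \<and> x \<noteq> qpar y"
    using xy ab(3-5) nodes(1,2)
    by (intro exI[of _ x] exI[of _ y]) (auto simp: qpar_nd nd_inject nd_in_Q)
qed

lemma qanc_nd:
  assumes "isnode m s" "isnode n t"
  shows "q.anc (nd m s) (nd n t) \<longleftrightarrow> s \<le> t \<and> anc m n"
proof
  have n: "n \<in> V" "t \<le> H n" using isnode_in[OF assms(2)] by auto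
  assume "q.anc (nd m s) (nd n t)"
  then obtain k where "(qpar ^^ k) (nd n t) = nd m s" by (auto simp: q.anc_def)
  then have "m = top n (t - k)" "s = t - k" by (auto simp: funpow_qpar[OF assms(2)] nd_inject)
  then show "s \<le> t \<and> anc m n" using top(1)[OF n(1), of "t - k"] n(2) by simp
next
  assume *: "s \<le> t \<and> anc m n"
  have "(qpar ^^ (t - s)) (nd n t) = nd m s"
    using funpow_qpar[OF assms(2), of "t - s"] top_eqI[OF _ _ assms(1), of n] * isnode_in[OF assms(2)]
    by simp
  then show "q.anc (nd m s) (nd n t)" unfolding q.anc_def by blast
qed

lemma qextra_crossing:
  assumes n: "isnode n t" and e: "e \<in> qextra" "crosses (q.sub (nd n t)) e"
  obtains a b s where "{a, b} \<in> S" "s = min (H a) (H b)" "e = {nd (top a s) s, nd (top b s) s}"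
    "crosses (sub n) {a, b}"
proof -
  obtain x y where xy: "e = {x, y}" "q.anc (nd n t) x" "\<not> q.anc (nd n t) y"
    using e(2) by (auto simp: crosses_def)
  with e(1) obtain a b s where ab: "{a, b} \<in> S" "s = min (H a) (H b)"
    "x = nd (top a s) s" "y = nd (top b s) s" by (auto elim: qextraE)
  note nodes = qextra_nodes[OF ab(1,2)]
  have t: "t \<le> s" "anc n (top a s)" using xy(2) qanc_nd[OF n nodes(1)] ab(3) by auto
  have "anc n a" using anc_trans[OF t(2) top(1)[OF nodes(3,5)]] .
  moreover have "\<not> anc n b"
  proof
    assume "anc n b"
    then have "top b t = n" using top_eqI[OF nodes(4) _ n] by blast
    then have "top (top b s) t = n" using top_top[OF nodes(4) t(1) nodes(6)] by simp
    moreover have "top b s \<in> V" "t \<le> H (top b s)" using isnode_in[OF nodes(2)] t(1) by auto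
    ultimately have "anc n (top b s)" using top(1)[of "top b s" t] by simp
    then show False using xy(3) qanc_nd[OF n nodes(2)] t(1) ab(4) by simp
  qed
  ultimately have "crosses (sub n) {a, b}" by (rule crosses_subI)
  then show ?thesis using that[OF ab(1,2)] xy(1) ab(3,4) by blast
qed

sublocale q: cactus_tree Q "nd r 0" qpar qextra
proof
  fix x e e' assume x: "x \<in> Q" and e: "e \<in> qextra" "e' \<in> qextra"
    "crosses (q.sub x) e" "crosses (q.sub x) e'"
  obtain n t where n: "x = nd n t" "isnode n t" using x unfolding Q_def by blast
  obtain a b s where ab: "{a, b} \<in> S" "s = min (H a) (H b)" "e = {nd (top a s) s, nd (top b s) s}"
    "crosses (sub n) {a, b}"
    using qextra_crossing[OF n(2) e(1)] e(3) n(1) by blast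
  obtain a' b' s' where ab': "{a', b'} \<in> S" "s' = min (H a') (H b')"
    "e' = {nd (top a' s') s', nd (top b' s') s'}" "crosses (sub n) {a', b'}"
    using qextra_crossing[OF n(2) e(2)] e(4) n(1) by blast
  have "{a, b} = {a', b'}" using one_extra[of n] isnode_in[OF n(2)] ab ab' by blast
  then show "e = e'" using ab(2,3) ab'(2,3)
    by (auto simp: doubleton_eq_iff min.commute)
qed

definition height :: "'q \<Rightarrow> nat" where
  "height x = snd (inv (\<lambda>(n, t). nd n t) x)"

lemma height_nd [simp]: "height (nd n t) = t"
  by (simp add: height_def inv_nd)

lemma qedge_height:
  assumes "{x, y} \<in> q.edges"
  shows "\<bar>real (height x) - real (height y)\<bar> \<le> 1"
  using assms unfolding q.edges_def
proof
  have *: "\<bar>real (height x) - real (height (qpar x))\<bar> \<le> 1"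
    if "x \<in> Q" for x
    using that by (auto simp: Q_def qpar_nd of_nat_diff)
  assume "{x, y} \<in> q.tree_edges"
  then show ?thesis by (cases rule: q.tree_edgeE) (use *[of x] *[of y] in auto)
next
  assume "{x, y} \<in> qextra"
  then show ?thesis by (auto elim!: qextraE)
qed

definition qdist :: "'q \<Rightarrow> 'q \<Rightarrow> real" where
  "qdist x y = path_dist Q q.edges (indicator {x}) (indicator {y})"

lemma qdist_height:
  assumes "isnode n t" "isnode m s"
  shows "\<bar>real t - real s\<bar> \<le> qdist (nd n t) (nd m s)"
  using path_dist_height[OF q.connected_edges nd_in_Q[OF assms(1)] nd_in_Q[OF assms(2)],
      of "\<lambda>x. real (height x)"] qedge_height
  by (simp add: qdist_def)

end

lemma (in cactus_tree) coarse_cactus_path_dist: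
  "coarse_cactus V r par S (\<lambda>x y. path_dist V edges (indicator {x}) (indicator {y})) 3 1"
proof -
  interpret M: Metric_space "realization V edges" "path_dist V edges"
    by (rule Metric_space_path_dist[OF connected_edges])
  note r = indicator_in_realization[of _ V edges]
  show ?thesis
  proof
    show "(u, v) \<in> (induced edges {w \<in> V. path_dist V edges (indicator {u}) (indicator {w}) +
        path_dist V edges (indicator {w}) (indicator {v}) \<le> path_dist V edges (indicator {u}) (indicator {v}) + 3})\<^sup>*"
      if "u \<in> V" "v \<in> V" for u v
      using path_dist_induced[OF connected_edges r[OF that(1)] r[OF that(2)] order_refl, of u v]
      by (simp add: supp_indicator)
  qed (auto simp: M.commute r M.triangle path_dist_edge[OF connected_edges])
qed

locale cactus_comparison = cactus_height V r par S H nd + coarse_cactus V r par S \<rho> K c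
  for V :: "'n set" and r par S H and nd :: "'n \<Rightarrow> nat \<Rightarrow> 'q" and \<rho> K c +
  fixes B :: real
  assumes H_close: "v \<in> V \<Longrightarrow> \<bar>real (H v) - \<rho> r v\<bar> \<le> B"
begin

sublocale qc: coarse_cactus Q "nd r 0" qpar qextra qdist 3 1
  unfolding qdist_def[abs_def] by (rule q.coarse_cactus_path_dist)

definition \<nu> :: "'n \<Rightarrow> 'q" where
  "\<nu> v = nd (top v (H v)) (H v)"

lemma \<nu>_node: "v \<in> V \<Longrightarrow> isnode (top v (H v)) (H v)"
  using top(2) by simp

lemma \<nu>_in: "v \<in> V \<Longrightarrow> \<nu> v \<in> Q"
  unfolding \<nu>_def using nd_in_Q \<nu>_node by simp

lemma top_in_Q: "v \<in> V \<Longrightarrow> t \<le> H v \<Longrightarrow> nd (top v t) t \<in> Q"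
  using nd_in_Q top(2) by simp

lemma qdist_climb:
  assumes v: "v \<in> V" and st: "s \<le> t" "t \<le> H v"
  shows "qdist (nd (top v s) s) (nd (top v t) t) \<le> real t - real s"
  using st
proof (induction t rule: dec_induct)
  case base
  then show ?case using qc.dist_self top_in_Q[OF v, of s] by simp
next
  case (step t)
  have t: "Suc t \<le> H v" "t \<le> H v" using step by auto
  define x where "x = nd (top v (Suc t)) (Suc t)"
  have x: "x \<in> Q" "x \<noteq> nd r 0" using top_in_Q[OF v t(1)] by (auto simp: x_def nd_inject)
  have "qpar x = nd (top v t) t" using top_top[OF v _ t(1), of t] by (simp add: x_def qpar_nd)
  then have "{nd (top v t) t, x} \<in> q.edges"
    using q.tree_edgeI[OF x] by (simp add: q.edges_def insert_commute)
  then have "qdist (nd (top v t) t) x \<le> 1" by (rule qc.edge_le)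
  moreover have "qdist (nd (top v s) s) x \<le> qdist (nd (top v s) s) (nd (top v t) t) + qdist (nd (top v t) t) x"
    by (rule qc.dist_tri) (use step t x top_in_Q[OF v] in auto)
  ultimately show ?case using step t by (simp add: x_def)
qed

lemma qdist_anc:
  assumes "v \<in> V" "anc i v"
  shows "qdist (\<nu> i) (\<nu> v) \<le> real (H v) - real (H i)" "qdist (\<nu> v) (\<nu> i) \<le> real (H v) - real (H i)"
proof -
  have i: "i \<in> V" "H i \<le> H v" using anc_in[OF assms(2,1)] H_anc[OF assms(2,1)] by auto
  show "qdist (\<nu> i) (\<nu> v) \<le> real (H v) - real (H i)"
    using qdist_climb[OF assms(1) i(2)] top_anc[OF assms, of "H i"] by (simp add: \<nu>_def)
  then show "qdist (\<nu> v) (\<nu> i) \<le> real (H v) - real (H i)"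
    using qc.dist_sym[OF \<nu>_in[OF i(1)] \<nu>_in[OF assms(1)]] by simp
qed

lemma H_diff:
  assumes "u \<in> V" "v \<in> V"
  shows "real (H u) - real (H v) \<le> \<rho> u v + 2 * B" "real (H u) - real (H v) \<le> \<rho> v u + 2 * B"
proof -
  have "\<rho> r u \<le> \<rho> r v + \<rho> v u" "\<rho> v u = \<rho> u v" by (intro dist_tri dist_sym root_in assms)+
  then show "real (H u) - real (H v) \<le> \<rho> u v + 2 * B" "real (H u) - real (H v) \<le> \<rho> v u + 2 * B"
    using H_close[OF assms(1)] H_close[OF assms(2)] by linarith+
qed

lemma H_edge: "{a, b} \<in> edges \<Longrightarrow> \<bar>real (H a) - real (H b)\<bar> \<le> c + 2 * B"
  using H_diff[of a b] H_diff[of b a] edges_in[of a b] edge_le[of a b] by fastforce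

lemma B_nonneg: "0 \<le> B"
  using H_close[OF root_in] by linarith

lemma qdist_upper:
  assumes u: "u \<in> V" and v: "v \<in> V"
  shows "qdist (\<nu> u) (\<nu> v) \<le> \<rho> u v + (3 * K + 3 * c + 12 * B + 1)"
  using near_dichotomy[OF u v]
proof (elim disjE exE conjE)
  fix z assume z: "anc z u" "anc z v" and le: "\<rho> u z + \<rho> z v \<le> \<rho> u v + 2 * K"
  have zV: "z \<in> V" using anc_in[OF z(1) u] .
  have "qdist (\<nu> u) (\<nu> v) \<le> qdist (\<nu> u) (\<nu> z) + qdist (\<nu> z) (\<nu> v)"
    by (intro qc.dist_tri \<nu>_in u v zV)
  then show ?thesis
    using qdist_anc(2)[OF u z(1)] qdist_anc(1)[OF v z(2)] H_diff(1)[OF u zV] H_diff(2)[OF v zV] le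
      K_nonneg c_nonneg B_nonneg by linarith
next
  fix a b i j assume ab: "{a, b} \<in> S" and i: "anc i u" "anc i a" and j: "anc j v" "anc j b"
    and le: "\<rho> u i + \<rho> i a + \<rho> b j + \<rho> j v \<le> \<rho> u v + 3 * K + c"
  define s where "s = min (H a) (H b)"
  note n = qextra_nodes[OF ab s_def]
  define \<alpha> \<beta> where "\<alpha> = nd (top a s) s" and "\<beta> = nd (top b s) s"
  have V: "i \<in> V" "j \<in> V" using anc_in i(1) j(1) u v by auto
  have Q: "\<alpha> \<in> Q" "\<beta> \<in> Q" unfolding \<alpha>_def \<beta>_def using n nd_in_Q by auto
  note Q = Q \<nu>_in[OF u] \<nu>_in[OF v] \<nu>_in[OF V(1)] \<nu>_in[OF V(2)] \<nu>_in[OF n(3)] \<nu>_in[OF n(4)]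
  have 1: "qdist \<alpha> \<beta> \<le> 1"
  proof (cases "top a s = top b s")
    case True
    then show ?thesis using qc.dist_self Q(1) unfolding \<alpha>_def \<beta>_def by simp
  next
    case False
    then have "{\<alpha>, \<beta>} \<in> q.edges"
      unfolding q.edges_def \<alpha>_def \<beta>_def using ab s_def by (auto simp: qextra_def)
    then show ?thesis by (rule qc.edge_le)
  qed
  have 2: "qdist \<alpha> (\<nu> a) \<le> real (H a) - s" "qdist \<beta> (\<nu> b) \<le> real (H b) - s"
    unfolding \<alpha>_def \<beta>_def \<nu>_def using qdist_climb n by auto
  have 3: "(real (H a) - s) + (real (H b) - s) \<le> c + 2 * B"
    using H_edge[of a b] ab unfolding s_def edges_def by (auto simp: min_def split: if_splits)
  have 4: "qdist (\<nu> u) (\<nu> v) \<le> qdist (\<nu> u) (\<nu> a) + qdist (\<nu> a) (\<nu> v)"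
    "qdist (\<nu> u) (\<nu> a) \<le> qdist (\<nu> u) (\<nu> i) + qdist (\<nu> i) (\<nu> a)"
    "qdist (\<nu> a) (\<nu> v) \<le> qdist (\<nu> a) \<alpha> + qdist \<alpha> (\<nu> v)"
    "qdist \<alpha> (\<nu> v) \<le> qdist \<alpha> \<beta> + qdist \<beta> (\<nu> v)"
    "qdist \<beta> (\<nu> v) \<le> qdist \<beta> (\<nu> b) + qdist (\<nu> b) (\<nu> v)"
    "qdist (\<nu> b) (\<nu> v) \<le> qdist (\<nu> b) (\<nu> j) + qdist (\<nu> j) (\<nu> v)"
    "qdist (\<nu> a) \<alpha> = qdist \<alpha> (\<nu> a)"
    by (intro qc.dist_tri qc.dist_sym Q)+
  show ?thesis
    using 1 2 3 4 qdist_anc(2)[OF u i(1)] qdist_anc(1)[OF n(3) i(2)] qdist_anc(2)[OF n(4) j(2)]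
      qdist_anc(1)[OF v j(1)] H_diff(1)[OF u V(1)] H_diff(2)[OF n(3) V(1)] H_diff(1)[OF n(4) V(2)]
      H_diff(2)[OF v V(2)] le K_nonneg c_nonneg B_nonneg by linarith
qed

lemma dist_common_ancestor:
  assumes "u \<in> V" "v \<in> V" "anc n u" "anc n v"
  shows "\<rho> u v \<le> real (H u) + real (H v) - 2 * real (H n) + (12 * B + 6 * K + 2 * c)"
proof -
  have n: "n \<in> V" using anc_in assms by blast
  have "\<rho> r n + \<rho> n w \<le> \<rho> r w + (4 * B + 3 * K + c)" if "w \<in> V" "anc n w" for w
    by (rule tree_geodesic[of "\<lambda>v. real (H v)"]) (use H_par H_close that in auto)
  from this[OF assms(1,3)] this[OF assms(2,4)]
  show ?thesis
    using dist_tri[OF assms(1) n assms(2)] dist_sym[OF assms(1) n]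
      H_close[OF assms(1)] H_close[OF assms(2)] H_close[OF n] by linarith
qed

lemma qdist_common_ancestor:
  assumes "isnode n t" "isnode n' t'" "isnode m s" "q.anc (nd m s) (nd n t)" "q.anc (nd m s) (nd n' t')"
  shows "real t + real t' - 2 * real (H m) \<le> qdist (nd n t) (nd m s) + qdist (nd m s) (nd n' t')"
  using qdist_height[OF assms(1,3)] qdist_height[OF assms(3,2)] isnode_in[OF assms(3)] by linarith

lemma qdist_lower:
  assumes u: "u \<in> V" and v: "v \<in> V"
  shows "\<rho> u v \<le> qdist (\<nu> u) (\<nu> v) + (28 * B + 12 * K + 7 * c + 10)"
  using qc.near_dichotomy[OF \<nu>_in[OF u] \<nu>_in[OF v]]
proof (elim disjE exE conjE)
  fix z assume z: "q.anc z (\<nu> u)" "q.anc z (\<nu> v)"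
    and le: "qdist (\<nu> u) z + qdist z (\<nu> v) \<le> qdist (\<nu> u) (\<nu> v) + 2 * 3"
  have "z \<in> Q" using q.anc_in[OF z(1) \<nu>_in[OF u]] .
  then obtain n t where n: "z = nd n t" "isnode n t" unfolding Q_def by blast
  have "anc n u" "anc n v"
    using z qanc_nd[OF n(2) \<nu>_node] anc_trans[OF _ top(1)[OF _ order_refl]] u v
    unfolding n(1) \<nu>_def by blast+
  then have "\<rho> u v \<le> real (H u) + real (H v) - 2 * real (H n) + (12 * B + 6 * K + 2 * c)"
    by (rule dist_common_ancestor[OF u v])
  moreover have "real (H u) + real (H v) - 2 * real (H n) \<le> qdist (\<nu> u) z + qdist z (\<nu> v)"
    using qdist_common_ancestor[OF \<nu>_node[OF u] \<nu>_node[OF v] n(2)] z unfolding n(1) \<nu>_def by blast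
  ultimately show ?thesis using le K_nonneg c_nonneg B_nonneg by linarith
next
  fix \<alpha> \<beta> i j assume \<alpha>\<beta>: "{\<alpha>, \<beta>} \<in> qextra" and i: "q.anc i (\<nu> u)" "q.anc i \<alpha>"
    and j: "q.anc j (\<nu> v)" "q.anc j \<beta>"
    and le: "qdist (\<nu> u) i + qdist i \<alpha> + qdist \<beta> j + qdist j (\<nu> v) \<le> qdist (\<nu> u) (\<nu> v) + 3 * 3 + 1"
  obtain a b s where ab: "{a, b} \<in> S" "s = min (H a) (H b)" "\<alpha> = nd (top a s) s" "\<beta> = nd (top b s) s"
    using \<alpha>\<beta> by (rule qextraE)
  note node = qextra_nodes[OF ab(1,2)]
  obtain n t where n: "i = nd n t" "isnode n t" using q.anc_in[OF i(1) \<nu>_in[OF u]] unfolding Q_def by blast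
  obtain m w where m: "j = nd m w" "isnode m w" using q.anc_in[OF j(1) \<nu>_in[OF v]] unfolding Q_def by blast
  have "anc n u" "anc m v"
    using i(1) j(1) qanc_nd[OF n(2) \<nu>_node] qanc_nd[OF m(2) \<nu>_node]
      anc_trans[OF _ top(1)[OF _ order_refl]] u v unfolding n(1) m(1) \<nu>_def by blast+
  moreover have "anc n a" "anc m b"
    using i(2) j(2) qanc_nd[OF n(2) node(1)] qanc_nd[OF m(2) node(2)]
      anc_trans[OF _ top(1)[OF node(3,5)]] anc_trans[OF _ top(1)[OF node(4,6)]]
    unfolding n(1) m(1) ab(3,4) by blast+
  ultimately have "\<rho> u a \<le> real (H u) + real (H a) - 2 * real (H n) + (12 * B + 6 * K + 2 * c)"
    "\<rho> b v \<le> real (H b) + real (H v) - 2 * real (H m) + (12 * B + 6 * K + 2 * c)"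
    using dist_common_ancestor[OF u node(3)] dist_common_ancestor[OF node(4) v] by blast+
  moreover have "real (H u) + real s - 2 * real (H n) \<le> qdist (\<nu> u) i + qdist i \<alpha>"
    using qdist_common_ancestor[OF \<nu>_node[OF u] node(1) n(2)] i unfolding n(1) \<nu>_def ab(3) by blast
  moreover have "real s + real (H v) - 2 * real (H m) \<le> qdist \<beta> j + qdist j (\<nu> v)"
    using qdist_common_ancestor[OF node(2) \<nu>_node[OF v] m(2)] j unfolding m(1) \<nu>_def ab(4) by blast
  moreover have "(real (H a) - s) + (real (H b) - s) \<le> c + 2 * B"
    using H_edge[of a b] ab(1) unfolding ab(2) edges_def by (auto simp: min_def split: if_splits)
  moreover have "\<rho> a b \<le> c" using edge_le ab(1) by (simp add: edges_def)
  moreover have "\<rho> u v \<le> \<rho> u a + \<rho> a v" "\<rho> a v \<le> \<rho> a b + \<rho> b v" using dist_tri u v node by blast+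
  ultimately show ?thesis using le K_nonneg c_nonneg B_nonneg by linarith
qed

lemma qdist_dense:
  assumes "x \<in> Q"
  shows "\<exists>v\<in>V. qdist x (\<nu> v) \<le> c + 2 * B"
proof -
  obtain n t where n: "x = nd n t" "isnode n t" using assms unfolding Q_def by blast
  have nV: "n \<in> V" "t \<le> H n" using isnode_in[OF n(2)] by auto
  have le: "qdist x (\<nu> n) \<le> real (H n) - real t"
    using qdist_climb[OF nV(1) nV(2)] top_node[OF n(2)] by (simp add: n(1) \<nu>_def)
  show ?thesis
  proof (cases "n = r")
    case True
    then show ?thesis using le H_root nV c_nonneg B_nonneg by (intro bexI[OF _ nV(1)]) auto
  next
    case False
    then have "{n, par n} \<in> edges" using tree_edgeI nV(1) by (simp add: edges_def)
    then have "real (H n) - real (H (par n)) \<le> c + 2 * B" using H_edge by fastforce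
    moreover have "H (par n) < t" using n(2) False by (simp add: isnode_def)
    ultimately show ?thesis using le by (intro bexI[OF _ nV(1)]) auto
  qed
qed

end

section \<open>Spanning trees with monotone heights\<close>

lemma ex_monotone_spanning_tree:
  fixes h m :: "'v \<Rightarrow> nat"
  assumes r: "r \<in> V" "h r = 0"
    and conn: "\<forall>v\<in>V. (r, v) \<in> (induced E {w \<in> V. h w \<le> m v})\<^sup>*"
  shows "\<exists>H par. H r = 0 \<and> par r = r \<and>
    (\<forall>v\<in>V. h v \<le> H v \<and> H v \<le> m v \<and> par v \<in> V \<and> H (par v) \<le> H v \<and> (\<exists>k. (par ^^ k) v = r)) \<and>
    (\<forall>v\<in>V - {r}. {v, par v} \<in> E)"
proof -
  define R where "R t = induced E {w \<in> V. h w \<le> t}" for t :: nat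
  define H where "H v = (LEAST t. (r, v) \<in> (R t)\<^sup>*)" for v
  define l where "l v = (LEAST k. (r, v) \<in> R (H v) ^^ k)" for v
  have H_le: "H v \<le> t" if "(r, v) \<in> (R t)\<^sup>*" for v t unfolding H_def using that by (rule Least_le)
  have Hm: "H v \<le> m v" if "v \<in> V" for v using H_le[of v "m v"] bspec[OF conn that] by (simp add: R_def)
  have H: "(r, v) \<in> (R (H v))\<^sup>*" if "v \<in> V" for v
    unfolding H_def by (rule LeastI[of _ "m v"]) (use bspec[OF conn that] in \<open>simp add: R_def\<close>)
  have l: "(r, v) \<in> R (H v) ^^ l v" if v: "v \<in> V" for v
    unfolding l_def by (rule LeastI_ex) (use H[OF v] in \<open>simp add: rtrancl_power\<close>)
  have H_r: "H r = 0" using H_le[of r 0] by simp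
  have pred: "\<exists>u. u \<in> V \<and> {v, u} \<in> E \<and> (H u < H v \<or> H u = H v \<and> l u < l v) \<and> h v \<le> H v"
    if v: "v \<in> V" "v \<noteq> r" for v
  proof -
    obtain k where k: "l v = Suc k" using l[OF v(1)] v(2) by (cases "l v") auto
    then obtain u where u: "(r, u) \<in> R (H v) ^^ k" "(u, v) \<in> R (H v)" using l[OF v(1)] by auto
    have "H u \<le> H v" by (rule H_le) (use u(1) in \<open>rule relpow_imp_rtrancl\<close>)
    moreover have "l u \<le> k" if "H u = H v" unfolding l_def using u(1) that by (intro Least_le) simp
    ultimately show ?thesis using u(2) k by (intro exI[of _ u]) (auto simp: R_def induced_def insert_commute)
  qed
  have "\<forall>v. \<exists>u. (v = r \<longrightarrow> u = r) \<and> (v \<in> V \<and> v \<noteq> r \<longrightarrow>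
      u \<in> V \<and> {v, u} \<in> E \<and> (H u < H v \<or> H u = H v \<and> l u < l v) \<and> h v \<le> H v)"
    using pred by blast
  from choice[OF this] obtain par where par_r: "par r = r"
    and par: "\<And>v. v \<in> V \<Longrightarrow> v \<noteq> r \<Longrightarrow> par v \<in> V \<and> {v, par v} \<in> E \<and>
      (H (par v) < H v \<or> H (par v) = H v \<and> l (par v) < l v) \<and> h v \<le> H v"
    by blast
  have reach: "\<exists>k. (par ^^ k) v = r" if "v \<in> V" for v
    using that
  proof (induction "(H v, l v)" arbitrary: v rule: wf_induct_rule[OF wf_lex_prod[OF wf_less_than wf_less_than]])
    case (1 v)
    show ?case
    proof (cases "v = r")
      case True
      then show ?thesis by (intro exI[of _ 0]) simp
    next
      case False
      then obtain k where "(par ^^ k) (par v) = r" using 1(1)[of "par v"] par[OF 1(2) False] by auto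
      then show ?thesis by (intro exI[of _ "Suc k"]) (simp add: funpow_swap1)
    qed
  qed
  have "h v \<le> H v \<and> H v \<le> m v \<and> par v \<in> V \<and> H (par v) \<le> H v \<and> (\<exists>k. (par ^^ k) v = r)"
    if v: "v \<in> V" for v
    using par[OF v] Hm[OF v] reach[OF v] par_r r H_r by (cases "v = r") auto
  moreover have "{v, par v} \<in> E" if "v \<in> V - {r}" for v using par[of v] that by auto
  ultimately show ?thesis using H_r par_r by (intro exI[of _ H] exI[of _ par]) auto
qed

section \<open>Coarse geodesics from a quasi-isometry\<close>

lemma quasi_inverse_between:
  fixes X :: "'a set" and d :: "'a \<Rightarrow> 'a \<Rightarrow> real" and V :: "'v set"
  assumes geo: "geodesic_space X d" and conn: "connected_graph V E"
    and qi: "quasi_isometric X d (realization V E) (path_dist V E)"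
  shows "\<exists>g M. 0 \<le> M \<and> g ` V \<subseteq> X \<and> (\<forall>u v. {u, v} \<in> E \<longrightarrow> d (g u) (g v) \<le> M) \<and>
    (\<forall>x\<in>X. \<exists>v\<in>V. d x (g v) \<le> M) \<and>
    (\<forall>u\<in>V. \<forall>v\<in>V. (u, v) \<in> (induced E {w \<in> V. d (g u) (g w) + d (g w) (g v) \<le> d (g u) (g v) + M})\<^sup>*)"
proof -
  have sg: "simple_graph V E" using conn by (simp add: connected_graph_def)
  define Y where "Y = realization V E"
  define D where "D = path_dist V E"
  interpret X: Metric_space X d using geo unfolding geodesic_space_def by (rule conjunct1)
  interpret Y: Metric_space Y D unfolding Y_def D_def by (rule Metric_space_path_dist[OF conn])
  from qi obtain F L C where qi': "F ` X \<subseteq> Y \<and> L \<ge> 1 \<and> C \<ge> 0 \<and>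
      (\<forall>x\<in>X. \<forall>x'\<in>X. d x x' / L - C \<le> D (F x) (F x') \<and> D (F x) (F x') \<le> L * d x x' + C) \<and>
      (\<forall>y\<in>Y. \<exists>x\<in>X. D y (F x) \<le> C)"
    unfolding quasi_isometric_def Y_def D_def by (elim exE)
  note F = conjunct1[OF qi'] and L = conjunct1[OF conjunct2[OF qi']]
    and C = conjunct1[OF conjunct2[OF conjunct2[OF qi']]]
    and qi'' = conjunct2[OF conjunct2[OF conjunct2[OF qi']]]
  have low: "d x x' / L - C \<le> D (F x) (F x')" and up: "D (F x) (F x') \<le> L * d x x' + C"
    if "x \<in> X" "x' \<in> X" for x x'
    using bspec[OF bspec[OF conjunct1[OF qi''] that(1)] that(2)] by auto
  note dense = bspec[OF conjunct2[OF qi'']]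
  have FY: "F x \<in> Y" if "x \<in> X" for x using F that by blast
  define \<iota> :: "'v \<Rightarrow> 'v \<Rightarrow> real" where "\<iota> v = indicator {v}" for v
  have iY: "\<iota> v \<in> Y" if "v \<in> V" for v
    unfolding \<iota>_def Y_def using that by (rule indicator_in_realization)
  have "\<forall>v\<in>V. \<exists>x\<in>X. D (\<iota> v) (F x) \<le> C" using dense iY by blast
  then obtain g where g: "\<And>v. v \<in> V \<Longrightarrow> g v \<in> X" "\<And>v. v \<in> V \<Longrightarrow> D (\<iota> v) (F (g v)) \<le> C" by metis
  have low': "d x x' \<le> L * (b + C)" if "x \<in> X" "x' \<in> X" "D (F x) (F x') \<le> b" for x x' b
  proof -
    have "d x x' / L \<le> b + C" using low[OF that(1,2)] that(3) by linarith
    then show ?thesis using L by (simp add: field_simps)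
  qed
  have close: "d x (g w) \<le> L * (b + 2 * C)" if "x \<in> X" "w \<in> V" "D (F x) (\<iota> w) \<le> b" for x w b
  proof -
    have "D (F x) (F (g w)) \<le> D (F x) (\<iota> w) + D (\<iota> w) (F (g w))"
      by (intro Y.triangle FY iY g that)
    then have "D (F x) (F (g w)) \<le> b + C" using that(3) g(2)[OF that(2)] by linarith
    from low'[OF that(1) g(1)[OF that(2)] this] show ?thesis by (simp add: algebra_simps)
  qed
  define b where "b = L + C"
  define M0 where "M0 = L * (b + 3 + 2 * C)"
  have M0: "L * (1 + 3 * C) \<le> M0" "0 \<le> M0"
    unfolding M0_def b_def using L C by (auto intro!: mult_left_mono)
  have edge: "d (g u) (g v) \<le> 2 * M0" if e: "{u, v} \<in> E" for u v
  proof -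
    have uv: "u \<in> V" "v \<in> V" using e sg by (auto simp: simple_graph_def)
    have "D (\<iota> u) (\<iota> v) = 1" unfolding D_def \<iota>_def by (rule path_dist_edge[OF conn e])
    moreover have "D (F (g u)) (\<iota> v) \<le> D (F (g u)) (\<iota> u) + D (\<iota> u) (\<iota> v)"
      by (intro Y.triangle FY iY g uv)
    ultimately have "D (F (g u)) (\<iota> v) \<le> 1 + C" using g(2)[OF uv(1)] Y.commute by simp
    from close[OF g(1)[OF uv(1)] uv(2) this] show ?thesis using M0 by (simp add: algebra_simps)
  qed
  have onto: "\<exists>v\<in>V. d x (g v) \<le> 2 * M0" if x: "x \<in> X" for x
  proof -
    have Fx: "F x \<in> realization V E" using FY[OF x] by (simp add: Y_def)
    obtain p where p: "p \<in> supp (F x)" using realization_supp(3)[OF sg Fx] by blast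
    then have pV: "p \<in> V" using realization_supp(2)[OF sg Fx] by blast
    have "D (F x) (\<iota> p) \<le> 1" unfolding D_def \<iota>_def by (rule path_dist_supp[OF sg Fx p])
    from close[OF x pV this] have "d x (g p) \<le> L * (1 + 2 * C)" .
    also have "\<dots> \<le> L * (1 + 3 * C)" using L C by (intro mult_left_mono) auto
    finally show ?thesis using M0 pV by (intro bexI[of _ p]) auto
  qed
  have between: "(u, v) \<in> (induced E {w \<in> V. d (g u) (g w) + d (g w) (g v) \<le> d (g u) (g v) + 2 * M0})\<^sup>*"
    (is "_ \<in> (induced E ?N)\<^sup>*") if uv: "u \<in> V" "v \<in> V" for u v
  proof -
    define T where "T = d (g u) (g v)"
    obtain \<gamma> where \<gamma>: "\<gamma> ` {0..T} \<subseteq> X" "\<gamma> 0 = g u" "\<gamma> T = g v"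
      "\<And>s t. s \<in> {0..T} \<Longrightarrow> t \<in> {0..T} \<Longrightarrow> d (\<gamma> s) (\<gamma> t) = \<bar>s - t\<bar>"
      using geo g(1) uv unfolding geodesic_space_def T_def by meson
    have T: "0 \<le> T" by (simp add: T_def)
    have \<gamma>X: "\<gamma> t \<in> X" if "t \<in> {0..T}" for t using \<gamma>(1) that by blast
    have N: "w \<in> ?N" if w: "w \<in> V" "t \<in> {0..T}" "D (F (\<gamma> t)) (\<iota> w) \<le> b + 3" for w t
    proof -
      have 1: "d (\<gamma> t) (g w) \<le> M0" unfolding M0_def by (rule close[OF \<gamma>X[OF w(2)] w(1,3)])
      have "d (g u) (g w) \<le> d (g u) (\<gamma> t) + d (\<gamma> t) (g w)" "d (g w) (g v) \<le> d (g w) (\<gamma> t) + d (\<gamma> t) (g v)"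
        by (intro X.triangle g uv w \<gamma>X)+
      moreover have "d (g u) (\<gamma> t) = t" "d (\<gamma> t) (g v) = T - t"
        using \<gamma>(4)[of 0 t] \<gamma>(4)[of t T] \<gamma>(2,3) w(2) T by auto
      ultimately show ?thesis using 1 w(1) X.commute[of "g w" "\<gamma> t"] unfolding T_def by simp
    qed
    have join: "(p, q) \<in> (induced E ?N)\<^sup>*"
      if y: "y \<in> Y" "z \<in> Y" "D y z \<le> b" "p \<in> supp y" "q \<in> supp z"
        and t: "t \<in> {0..T}" "y = F (\<gamma> t) \<or> z = F (\<gamma> t)" for y z p q t
    proof -
      have "{w \<in> V. D y (\<iota> w) + D (\<iota> w) z \<le> b + 3} \<subseteq> ?N"
      proof
        fix w assume w: "w \<in> {w \<in> V. D y (\<iota> w) + D (\<iota> w) z \<le> b + 3}"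
        then have "D y (\<iota> w) + D (\<iota> w) z \<le> b + 3" by blast
        then have "D y (\<iota> w) \<le> b + 3" "D z (\<iota> w) \<le> b + 3"
          using Y.nonneg[of y "\<iota> w"] Y.nonneg[of "\<iota> w" z] Y.commute[of "\<iota> w" z] by linarith+
        then have "D (F (\<gamma> t)) (\<iota> w) \<le> b + 3" using t(2) by metis
        then show "w \<in> ?N" using N[OF _ t(1)] w by blast
      qed
      moreover have "(p, q) \<in> (induced E {w \<in> V. D y (\<iota> w) + D (\<iota> w) z \<le> b + 3})\<^sup>*"
        unfolding D_def \<iota>_def
        by (rule path_dist_induced[OF conn]) (use y in \<open>simp_all add: Y_def D_def\<close>)
      ultimately show ?thesis using induced_mono by blast
    qed
    have supp: "supp (F (\<gamma> t)) \<noteq> {}" if "t \<in> {0..T}" for t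
      using realization_supp(3)[OF sg] FY[OF \<gamma>X[OF that]] by (simp add: Y_def)
    have supp_\<iota>: "w \<in> supp (\<iota> w)" for w by (simp add: \<iota>_def supp_indicator)
    have step: "(p, q) \<in> (induced E ?N)\<^sup>*"
      if st: "s \<in> {0..T}" "t \<in> {0..T}" "\<bar>s - t\<bar> \<le> 1" "p \<in> supp (F (\<gamma> s))" "q \<in> supp (F (\<gamma> t))" for s t p q
    proof (rule join[OF _ _ _ st(4,5,1)])
      have "D (F (\<gamma> s)) (F (\<gamma> t)) \<le> L * \<bar>s - t\<bar> + C"
        using up[OF \<gamma>X \<gamma>X, OF st(1,2)] \<gamma>(4)[OF st(1,2)] by simp
      also have "\<dots> \<le> b" unfolding b_def using L st(3) mult_left_mono[of "\<bar>s - t\<bar>" 1 L] by simp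
      finally show "D (F (\<gamma> s)) (F (\<gamma> t)) \<le> b" .
    qed (use FY \<gamma>X st in auto)
    have C_le: "C \<le> b" using L by (simp add: b_def)
    have reach: "real k \<le> T \<Longrightarrow> \<forall>q\<in>supp (F (\<gamma> k)). (u, q) \<in> (induced E ?N)\<^sup>*" for k :: nat
    proof (induction k)
      case 0
      show ?case
      proof
        fix q assume q: "q \<in> supp (F (\<gamma> (real 0)))"
        have "D (\<iota> u) (F (\<gamma> 0)) \<le> b" using g(2)[OF uv(1)] \<gamma>(2) C_le by simp
        then show "(u, q) \<in> (induced E ?N)\<^sup>*"
          using join[OF iY[OF uv(1)] FY[OF \<gamma>X] _ supp_\<iota> _ _ disjI2, of 0 q 0] q T by simp
      qed
    next
      case (Suc k)
      then have k: "real k \<in> {0..T}" "real (Suc k) \<in> {0..T}" by auto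
      obtain p where p: "p \<in> supp (F (\<gamma> k))" using supp[OF k(1)] by blast
      have "(u, p) \<in> (induced E ?N)\<^sup>*" using Suc p by auto
      then show ?case using step[OF k _ p] rtrancl_trans by fastforce
    qed
    define k where "k = nat \<lfloor>T\<rfloor>"
    have k: "real k \<le> T" "T \<le> real k + 1" unfolding k_def using T by linarith+
    obtain p q where pq: "p \<in> supp (F (\<gamma> k))" "q \<in> supp (F (\<gamma> T))"
      using supp[of k] supp[of T] k T by fastforce
    have "(u, p) \<in> (induced E ?N)\<^sup>*" using reach k(1) pq(1) by blast
    also have "(p, q) \<in> (induced E ?N)\<^sup>*" using step[of k T, OF _ _ _ pq] k T by auto
    also have "(q, v) \<in> (induced E ?N)\<^sup>*"
    proof -
      have "D (F (\<gamma> T)) (\<iota> v) \<le> b" using g(2)[OF uv(2)] \<gamma>(3) C_le Y.commute by simp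
      then show ?thesis
        using join[OF FY[OF \<gamma>X] iY[OF uv(2)] _ pq(2) supp_\<iota> _ disjI1, of T] T by simp
    qed
    finally show ?thesis .
  qed
  show ?thesis
    using M0(2) g(1) edge onto between by (intro exI[of _ g] exI[of _ "2 * M0"]) auto
qed

theorem corollary1p1:
  fixes X :: "'a set" and d :: "'a \<Rightarrow> 'a \<Rightarrow> real"
    and VP :: "'v set" and EP :: "'v set set"
  assumes "geodesic_space X d"
    and "cactus VP EP"
    and "quasi_isometric X d (realization VP EP) (path_dist VP EP)"
  shows "\<exists>(K :: real) (VQ :: ('a, 'v) label set) (EQ :: ('a, 'v) label set set).
           cactus VQ EQ \<and> quasi_isometric_1 K X d (realization VQ EQ) (path_dist VQ EQ)"
proof -
  have conn: "connected_graph VP EP" using assms(2) by (simp add: cactus_def)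
  then have sg: "simple_graph VP EP" and "VP \<noteq> {}" by (auto simp: connected_graph_def)
  then obtain r where r: "r \<in> VP" by blast
  interpret X: Metric_space X d using assms(1) unfolding geodesic_space_def by (rule conjunct1)
  from quasi_inverse_between[OF assms(1) conn assms(3)] obtain g M where gM: "0 \<le> M \<and>
    g ` VP \<subseteq> X \<and> (\<forall>u v. {u, v} \<in> EP \<longrightarrow> d (g u) (g v) \<le> M) \<and>
    (\<forall>x\<in>X. \<exists>v\<in>VP. d x (g v) \<le> M) \<and>
    (\<forall>u\<in>VP. \<forall>v\<in>VP. (u, v) \<in> (induced EP
      {w \<in> VP. d (g u) (g w) + d (g w) (g v) \<le> d (g u) (g v) + M})\<^sup>*)"
    by (elim exE)
  note M = conjunct1[OF gM] and gM = conjunct2[OF gM]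
  have g: "g v \<in> X" if "v \<in> VP" for v using subsetD[OF conjunct1[OF gM]] that by simp
  note gM = conjunct2[OF gM]
  have edge: "d (g u) (g v) \<le> M" if "{u, v} \<in> EP" for u v using conjunct1[OF gM] that by simp
  note gM = conjunct2[OF gM]
  note onto = conjunct1[OF gM]
  have between: "(u, v) \<in> (induced EP {w \<in> VP. d (g u) (g w) + d (g w) (g v) \<le> d (g u) (g v) + M})\<^sup>*"
    if "u \<in> VP" "v \<in> VP" for u v by (rule bspec[OF bspec[OF conjunct2[OF gM] that(1)] that(2)])
  define \<rho> where "\<rho> u v = d (g u) (g v)" for u v
  have \<rho>_nonneg: "0 \<le> \<rho> u v" for u v by (simp add: \<rho>_def)
  define h m where "h v = nat \<lfloor>\<rho> r v\<rfloor>" and "m v = nat \<lfloor>\<rho> r v + M\<rfloor>" for v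
  have conn_h: "\<forall>v\<in>VP. (r, v) \<in> (induced EP {w \<in> VP. h w \<le> m v})\<^sup>*"
  proof
    fix v assume v: "v \<in> VP"
    have "{w \<in> VP. \<rho> r w + \<rho> w v \<le> \<rho> r v + M} \<subseteq> {w \<in> VP. h w \<le> m v}"
    proof
      fix w assume w: "w \<in> {w \<in> VP. \<rho> r w + \<rho> w v \<le> \<rho> r v + M}"
      then have "\<rho> r w \<le> \<rho> r v + M" using \<rho>_nonneg[of w v] by simp
      then show "w \<in> {w \<in> VP. h w \<le> m v}" using w unfolding h_def m_def
        by (auto intro!: nat_mono floor_mono)
    qed
    then show "(r, v) \<in> (induced EP {w \<in> VP. h w \<le> m v})\<^sup>*"
      using between[OF r v] induced_mono unfolding \<rho>_def by blast
  qed
  have h_r: "h r = 0" using X.mdist_zero g r by (simp add: h_def \<rho>_def)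
  from ex_monotone_spanning_tree[OF r h_r conn_h] obtain H par where tree: "H r = 0 \<and> par r = r \<and>
    (\<forall>v\<in>VP. h v \<le> H v \<and> H v \<le> m v \<and> par v \<in> VP \<and> H (par v) \<le> H v \<and> (\<exists>k. (par ^^ k) v = r)) \<and>
    (\<forall>v\<in>VP - {r}. {v, par v} \<in> EP)"
    by (elim exE)
  note H_r = conjunct1[OF tree] and par_r = conjunct1[OF conjunct2[OF tree]]
    and tree = conjunct2[OF conjunct2[OF tree]]
  note H = bspec[OF conjunct1[OF tree]] and tree_edge = bspec[OF conjunct2[OF tree]]
  define S where "S = EP - (\<lambda>n. {n, par n}) ` (VP - {r})"
  interpret T: rooted_tree VP r par S
  proof
    fix e assume e: "e \<in> S"
    then have sub: "e \<subseteq> VP" and "card e = 2" using sg unfolding S_def simple_graph_def by simp_all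
    then obtain a b where "e = {a, b}" "a \<noteq> b" unfolding card_2_iff by (elim exE conjE)
    then have ab: "e = {a, b}" "a \<noteq> b" "a \<in> VP" "b \<in> VP" using sub by simp_all
    have not_par: "y \<noteq> par x" if xy: "e = {x, y}" "x \<noteq> y" "x \<in> VP" for x y
    proof
      assume y: "y = par x"
      then have "x \<in> VP - {r}" using xy par_r by auto
      then have "{x, par x} \<in> (\<lambda>n. {n, par n}) ` (VP - {r})" by (rule imageI)
      then show False using e xy(1) y unfolding S_def by simp
    qed
    have "b \<noteq> par a" "a \<noteq> par b"
      using not_par[of a b] not_par[of b a] ab by (simp_all add: insert_commute)
    then show "\<exists>a b. e = {a, b} \<and> a \<in> VP \<and> b \<in> VP \<and> a \<noteq> b \<and> b \<noteq> par a \<and> a \<noteq> par b"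
      using ab by blast
  qed (use r H par_r in auto)
  have "(\<lambda>n. {n, par n}) ` (VP - {r}) \<subseteq> EP" by (rule image_subsetI) (rule tree_edge)
  then have edges: "T.edges = EP" unfolding T.edges_def T.tree_edges_def by (subst S_def) blast
  define nd :: "'v \<Rightarrow> nat \<Rightarrow> ('a, 'v) label" where "nd n t = [Inr (Inl n), Inr (Inr t)]" for n t
  define B where "B = M + 1"
  interpret cactus_comparison VP r par S H nd \<rho> M M B
  proof
    show "e = e'" if "v \<in> VP" "e \<in> S" "e' \<in> S" "crosses (T.sub v) e" "crosses (T.sub v) e'" for v e e'
      using T.cactus_one_extra[of v e e'] that assms(2) by (simp add: edges)
    show "(nd a s = nd b t) = (a = b \<and> s = t)" for a s b t by (auto simp: nd_def)
    show "\<rho> x x = 0" if "x \<in> VP" for x using that g by (simp add: \<rho>_def)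
    show "\<rho> x y = \<rho> y x" for x y by (simp add: \<rho>_def X.commute)
    show "\<rho> x z \<le> \<rho> x y + \<rho> y z" if "x \<in> VP" "y \<in> VP" "z \<in> VP" for x y z
      unfolding \<rho>_def using that by (intro X.triangle g)
    show "\<rho> x y \<le> M" if "{x, y} \<in> T.edges" for x y using edge that by (simp add: edges \<rho>_def)
    show "(u, v) \<in> (induced T.edges {w \<in> VP. \<rho> u w + \<rho> w v \<le> \<rho> u v + M})\<^sup>*"
      if "u \<in> VP" "v \<in> VP" for u v using between[OF that] by (simp add: edges \<rho>_def)
    show "\<bar>real (H v) - \<rho> r v\<bar> \<le> B" if v: "v \<in> VP" for v
    proof -
      have "real (h v) \<le> H v" "real (H v) \<le> m v" using H[OF v] by auto
      moreover have "\<rho> r v - 1 \<le> h v" "real (m v) \<le> \<rho> r v + M"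
        unfolding h_def m_def using \<rho>_nonneg[of r v] M by linarith+
      ultimately show ?thesis using M by (simp add: B_def abs_le_iff)
    qed
  qed (use H H_r M in auto)
  define A where "A = 28 * B + 19 * M + 10"
  have \<nu>_close: "\<bar>qdist (\<nu> u) (\<nu> v) - \<rho> u v\<bar> \<le> A" if "u \<in> VP" "v \<in> VP" for u v
    using qdist_upper[OF that] qdist_lower[OF that] M unfolding A_def B_def by (simp add: abs_le_iff)
  from bchoice[OF onto[unfolded Bex_def]] obtain \<pi> where
    "\<forall>x\<in>X. \<pi> x \<in> VP \<and> d x (g (\<pi> x)) \<le> M" by (elim exE)
  then have \<pi>: "\<pi> x \<in> VP" "d x (g (\<pi> x)) \<le> M" if "x \<in> X" for x using that by auto
  define F :: "'a \<Rightarrow> ('a, 'v) label \<Rightarrow> real" where "F x = indicator {\<nu> (\<pi> x)}" for x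
  interpret Y: Metric_space "realization Q q.edges" "path_dist Q q.edges"
    by (rule Metric_space_path_dist[OF q.connected_edges])
  have "quasi_isometry_1 (A + 4 * M + 2 * B + 1) X d (realization Q q.edges) (path_dist Q q.edges) F"
    unfolding quasi_isometry_1_def
  proof (intro conjI ballI)
    show "F ` X \<subseteq> realization Q q.edges"
      using indicator_in_realization[OF \<nu>_in[OF \<pi>(1)]] by (auto simp: F_def)
  next
    fix x x' assume x: "x \<in> X" "x' \<in> X"
    have "d x x' \<le> d x (g (\<pi> x)) + d (g (\<pi> x)) x'" "d (g (\<pi> x)) x' \<le> \<rho> (\<pi> x) (\<pi> x') + d (g (\<pi> x')) x'"
      "\<rho> (\<pi> x) (\<pi> x') \<le> d (g (\<pi> x)) x + d x (g (\<pi> x'))" "d x (g (\<pi> x')) \<le> d x x' + d x' (g (\<pi> x'))"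
      unfolding \<rho>_def by (intro X.triangle g \<pi> x)+
    then have "\<bar>\<rho> (\<pi> x) (\<pi> x') - d x x'\<bar> \<le> 2 * M"
      using \<pi>(2)[OF x(1)] \<pi>(2)[OF x(2)] X.commute[of "g (\<pi> x)" x] X.commute[of "g (\<pi> x')" x']
      by (simp add: abs_le_iff)
    moreover have "\<bar>path_dist Q q.edges (F x) (F x') - \<rho> (\<pi> x) (\<pi> x')\<bar> \<le> A"
      using \<nu>_close[OF \<pi>(1) \<pi>(1), OF x] by (simp add: F_def qdist_def)
    ultimately have "\<bar>path_dist Q q.edges (F x) (F x') - d x x'\<bar> \<le> A + 2 * M"
      using abs_triangle_ineq[of "path_dist Q q.edges (F x) (F x') - \<rho> (\<pi> x) (\<pi> x')" "\<rho> (\<pi> x) (\<pi> x') - d x x'"]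
      by simp
    also have "\<dots> \<le> A + 4 * M + 2 * B + 1" using M by (simp add: B_def)
    finally show "\<bar>path_dist Q q.edges (F x) (F x') - d x x'\<bar> \<le> A + 4 * M + 2 * B + 1" .
  next
    fix y assume y: "y \<in> realization Q q.edges"
    obtain p where p: "p \<in> supp y" using realization_supp(3)[OF q.simple_edges y] by blast
    have pQ: "p \<in> Q" using realization_supp(2)[OF q.simple_edges y] p by blast
    obtain v where v: "v \<in> VP" "qdist p (\<nu> v) \<le> M + 2 * B" using qdist_dense[OF pQ] by blast
    define w where "w = \<pi> (g v)"
    have w: "w \<in> VP" "\<rho> v w \<le> M" using \<pi>[OF g[OF v(1)]] by (auto simp: w_def \<rho>_def)
    note ind = indicator_in_realization[of _ Q q.edges]
    have "path_dist Q q.edges y (indicator {p}) \<le> 1" by (rule path_dist_supp[OF q.simple_edges y p])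
    moreover have "path_dist Q q.edges y (F (g v)) \<le> path_dist Q q.edges y (indicator {p}) + qdist p (\<nu> w)"
      unfolding qdist_def F_def w_def[symmetric] by (intro Y.triangle y ind pQ \<nu>_in w)
    moreover have "qdist p (\<nu> w) \<le> qdist p (\<nu> v) + qdist (\<nu> v) (\<nu> w)"
      by (intro qc.dist_tri pQ \<nu>_in v w)
    moreover have "qdist (\<nu> v) (\<nu> w) \<le> A + M" using \<nu>_close[OF v(1) w(1)] w(2) by linarith
    ultimately have "path_dist Q q.edges y (F (g v)) \<le> A + 4 * M + 2 * B + 1" using v(2) M by linarith
    then show "\<exists>x\<in>X. path_dist Q q.edges y (F x) \<le> A + 4 * M + 2 * B + 1" using g[OF v(1)] by blast
  qed
  then show ?thesis using q.cactus_edges unfolding quasi_isometric_1_def by blast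
qed

end
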